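(* Consider the single-cell uplink with aged CSI and ZF receivers described in the context, with $K$, $\tau$, $\alpha$ and $\beta_1,\dots,\beta_K$ fixed. Fix $E_u>0$ and $\gamma>0$, and let each user's transmit power be $p_u=E_u/M^\gamma$. Then for every $k\in\{1,\dots,K\}$, $$R_k^{\mathrm{a,zf}}-\log_2\left(1+\frac{\alpha^2\tau E_u^2\beta_k^2}{M^{2\gamma-1}}\right)\longrightarrow 0\qquad (M\to\infty).$$
   Context: System: a base station (BS) with $M$ antennas and $K\le M$ single-antenna users; $p_u>0$ is the transmit power per user, $\tau\ge K$ the (integer) training length, $p_p:=\tau p_u$, and $\beta_1,\dots,\beta_K>0$ are constants (large-scale fading). The channel vector of user $k$ at time $n$ is $\mathbf g_k[n]\in\mathbb C^M$ with i.i.d. $\mathcal{CN}(0,\beta_k)$ entries, independent across users. Estimation: the BS observes $\tilde{\mathbf y}_k[n]=\mathbf g_k[n]+\frac{1}{\sqrt{p_p}}\mathbf b_k[n]$, where the $\mathbf b_k[n]$ have i.i.d. $\mathcal{CN}(0,1)$ entries, are independent across $k$ and independent of the channels. The MMSE estimate is $\hat{\mathbf g}_k[n]=\frac{p_p\beta_k}{1+p_p\beta_k}\tilde{\mathbf y}_k[n]$; its entries are i.i.d. $\mathcal{CN}\left(0,\frac{p_p\beta_k^2}{1+p_p\beta_k}\right)$, independent across $k$. Aging: $\mathbf g_k[n+1]=\alpha\mathbf g_k[n]+\mathbf e_k[n+1]$, where $\alpha$ is real with $0<|\alpha|\le1$ and $\mathbf e_k[n+1]$ is independent of the foregoing with i.i.d.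 $\mathcal{CN}(0,(1-\alpha^2)\beta_k)$ entries. The BS uses the aged CSI $\bar{\mathbf g}_k[n+1]=\alpha\hat{\mathbf g}_k[n]$; write $\bar{\mathbf G}=[\bar{\mathbf g}_1[n+1],\dots,\bar{\mathbf g}_K[n+1]]\in\mathbb C^{M\times K}$. Rate: with linear detector vector $\hat{\mathbf a}_k$ for user $k$, the achievable rate of user $k$ is defined as $$R_k=\mathrm E\left\{\log_2\left(1+\frac{p_u|\hat{\mathbf a}_k^\dagger\bar{\mathbf g}_k|^2}{p_u\sum_{i\ne k}|\hat{\mathbf a}_k^\dagger\bar{\mathbf g}_i|^2+\|\hat{\mathbf a}_k\|^2\left(p_u\sum_{i=1}^K\left(\beta_i-\alpha^2\frac{p_p\beta_i^2}{1+p_p\beta_i}\right)+1\right)}\right)\right\},$$ where $\bar{\mathbf g}_i=\bar{\mathbf g}_i[n+1]$ and $^\dagger$ is conjugate transpose. The ZF receiver takes $\hat{\mathbf a}_k$ to be the $k$-th column of $\bar{\mathbf G}(\bar{\mathbf G}^\dagger\bar{\mathbf G})^{-1}$ (the inverse exists almost surely), and the resulting $R_k$ is denoted $R_k^{\mathrm{a,zf}}$. *)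

theory Defs
  imports
    "HOL-Probability.Probability"
    "Jordan_Normal_Form.Gauss_Jordan_Elimination"
    "Jordan_Normal_Form.Schur_Decomposition"
begin

text \<open>
  Conventions: users are numbered \<open>0, \<dots>, K - 1\<close> and antennas \<open>0, \<dots>, M - 1\<close>.
  The entry of antenna \<open>m\<close> in the vector of user \<open>k\<close> is the complex random variable \<open>g k m\<close>.
\<close>

text \<open>
  The circularly symmetric law \<open>CN(0, v)\<close>, as the law of \<open>sqrt (v/2) * (X + i Y)\<close> with
  \<open>X\<close>, \<open>Y\<close> independent and standard normal. It is the point mass at 0 for \<open>v = 0\<close>, which occurs
  for the innovation when \<open>\<bar>\<alpha>\<bar> = 1\<close>.
\<close>
definition std_normal_law :: "real measure" where
  "std_normal_law = density lborel (\<lambda>x. ennreal (std_normal_density x))"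

definition complex_normal_law :: "real \<Rightarrow> complex measure" where
  "complex_normal_law v =
     distr (std_normal_law \<Otimes>\<^sub>M std_normal_law) borel
       (\<lambda>(x, y). complex_of_real (sqrt (v / 2)) * Complex x y)"

text \<open>\<open>Channel k m\<close>, \<open>Noise k m\<close>, \<open>Innovation k m\<close> index the scalar sources of randomness.\<close>
datatype source = Channel nat nat | Noise nat nat | Innovation nat nat

definition sources :: "nat \<Rightarrow> nat \<Rightarrow> source set" where
  "sources M K =
     (\<Union>k<K. \<Union>m<M. {Channel k m, Noise k m, Innovation k m})"

text \<open>
  \<open>g\<close> is the channel at time \<open>n\<close>, \<open>b\<close> the pilot noise at time \<open>n\<close>, \<open>e\<close> the innovation at time
  \<open>n + 1\<close> and \<open>g_next\<close> the channel at time \<open>n + 1\<close>.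
\<close>
locale aged_uplink = prob_space \<Omega> for \<Omega> :: "'w measure" +
  fixes M K :: nat
    and \<alpha> :: real
    and \<beta> :: "nat \<Rightarrow> real"
    and g b e g_next :: "nat \<Rightarrow> nat \<Rightarrow> 'w \<Rightarrow> complex"
  assumes independent_sources:
      "indep_vars (\<lambda>_. borel) (case_source g b e) (sources M K)"
    and channel_law:
      "\<And>k m. k < K \<Longrightarrow> m < M \<Longrightarrow> distr \<Omega> borel (g k m) = complex_normal_law (\<beta> k)"
    and noise_law:
      "\<And>k m. k < K \<Longrightarrow> m < M \<Longrightarrow> distr \<Omega> borel (b k m) = complex_normal_law 1"
    and innovation_law:
      "\<And>k m. k < K \<Longrightarrow> m < M \<Longrightarrow>
         distr \<Omega> borel (e k m) = complex_normal_law ((1 - \<alpha>\<^sup>2) * \<beta> k)"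
    and aging:
      "\<And>k m \<omega>. k < K \<Longrightarrow> m < M \<Longrightarrow> \<omega> \<in> space \<Omega> \<Longrightarrow>
         g_next k m \<omega> = complex_of_real \<alpha> * g k m \<omega> + e k m \<omega>"

definition pilot_power :: "nat \<Rightarrow> real \<Rightarrow> real" where
  "pilot_power \<tau> pu = real \<tau> * pu"

definition observation ::
  "real \<Rightarrow> (nat \<Rightarrow> nat \<Rightarrow> 'w \<Rightarrow> complex) \<Rightarrow> (nat \<Rightarrow> nat \<Rightarrow> 'w \<Rightarrow> complex) \<Rightarrow>
   nat \<Rightarrow> nat \<Rightarrow> 'w \<Rightarrow> complex" where
  "observation pp g b k m \<omega> = g k m \<omega> + complex_of_real (1 / sqrt pp) * b k m \<omega>"

definition mmse_estimate ::
  "real \<Rightarrow> (nat \<Rightarrow> real) \<Rightarrow> (nat \<Rightarrow> nat \<Rightarrow> 'w \<Rightarrow> complex) \<Rightarrow> (nat \<Rightarrow> nat \<Rightarrow> 'w \<Rightarrow> complex) \<Rightarrow>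
   nat \<Rightarrow> nat \<Rightarrow> 'w \<Rightarrow> complex" where
  "mmse_estimate pp \<beta> g b k m \<omega> =
     complex_of_real (pp * \<beta> k / (1 + pp * \<beta> k)) * observation pp g b k m \<omega>"

definition aged_csi ::
  "nat \<Rightarrow> nat \<Rightarrow> real \<Rightarrow> real \<Rightarrow> (nat \<Rightarrow> real) \<Rightarrow>
   (nat \<Rightarrow> nat \<Rightarrow> 'w \<Rightarrow> complex) \<Rightarrow> (nat \<Rightarrow> nat \<Rightarrow> 'w \<Rightarrow> complex) \<Rightarrow> 'w \<Rightarrow> complex mat" where
  "aged_csi M K pp \<alpha> \<beta> g b \<omega> =
     mat M K (\<lambda>(m, k). complex_of_real \<alpha> * mmse_estimate pp \<beta> g b k m \<omega>)"

definition herm_prod :: "complex vec \<Rightarrow> complex vec \<Rightarrow> complex" where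
  "herm_prod a v = scalar_prod (conjugate a) v"

definition sq_norm_vec :: "complex vec \<Rightarrow> real" where
  "sq_norm_vec a = (\<Sum>m<dim_vec a. (cmod (vec_index a m))\<^sup>2)"

definition sinr ::
  "nat \<Rightarrow> real \<Rightarrow> real \<Rightarrow> real \<Rightarrow> (nat \<Rightarrow> real) \<Rightarrow> complex mat \<Rightarrow> complex vec \<Rightarrow> nat \<Rightarrow> real" where
  "sinr K pu pp \<alpha> \<beta> G a k =
     pu * (cmod (herm_prod a (col G k)))\<^sup>2 /
     (pu * (\<Sum>i\<in>{..<K} - {k}. (cmod (herm_prod a (col G i)))\<^sup>2)
      + sq_norm_vec a *
        (pu * (\<Sum>i<K. \<beta> i - \<alpha>\<^sup>2 * (pp * (\<beta> i)\<^sup>2 / (1 + pp * \<beta> i))) + 1))"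

text \<open>
  The rate for an arbitrary linear receiver; \<open>detector\<close> maps the \<open>M \<times> K\<close> matrix of aged CSI to the
  \<open>M \<times> K\<close> matrix whose \<open>k\<close>-th column is the detector vector of user \<open>k\<close>.
\<close>
definition achievable_rate ::
  "(complex mat \<Rightarrow> complex mat) \<Rightarrow> 'w measure \<Rightarrow> nat \<Rightarrow> nat \<Rightarrow> nat \<Rightarrow> real \<Rightarrow> real \<Rightarrow> (nat \<Rightarrow> real) \<Rightarrow>
   (nat \<Rightarrow> nat \<Rightarrow> 'w \<Rightarrow> complex) \<Rightarrow> (nat \<Rightarrow> nat \<Rightarrow> 'w \<Rightarrow> complex) \<Rightarrow> nat \<Rightarrow> real" where
  "achievable_rate detector \<Omega> M K \<tau> pu \<alpha> \<beta> g b k =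
     (let pp = pilot_power \<tau> pu; G = aged_csi M K pp \<alpha> \<beta> g b
      in integral\<^sup>L \<Omega>
           (\<lambda>\<omega>. log 2 (1 + sinr K pu pp \<alpha> \<beta> (G \<omega>) (col (detector (G \<omega>)) k) k)))"

text \<open>
  \<open>mat_inverse\<close> is \<open>None\<close> exactly on singular square matrices. The default 0 is therefore used only
  when \<open>G\<close> lacks full column rank; it keeps the detector a measurable function of \<open>G\<close>.
\<close>
definition zf_detector :: "complex mat \<Rightarrow> complex mat" where
  "zf_detector G =
     (case mat_inverse (mat_adjoint G * G) of
        Some B \<Rightarrow> G * B
      | None \<Rightarrow> 0\<^sub>m (dim_row G) (dim_col G))"

definition rate_aged_zf ::
  "'w measure \<Rightarrow> nat \<Rightarrow> nat \<Rightarrow> nat \<Rightarrow> real \<Rightarrow> real \<Rightarrow> (nat \<Rightarrow> real) \<Rightarrow>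
   (nat \<Rightarrow> nat \<Rightarrow> 'w \<Rightarrow> complex) \<Rightarrow> (nat \<Rightarrow> nat \<Rightarrow> 'w \<Rightarrow> complex) \<Rightarrow> nat \<Rightarrow> real" where
  "rate_aged_zf = achievable_rate zf_detector"

end

theory Submission
  imports Defs "Jordan_Normal_Form.Determinant" "HOL-Real_Asymp.Real_Asymp"
begin

text \<open>
  The zero-forcing SINR equals \<open>a / y k\<close>, where \<open>y\<close> solves \<open>H y = e\<^sub>k\<close> for the Gram matrix
  \<open>H = (1/M) Z\<^sup>\<dagger> Z\<close> of the standardized CSI \<open>Z\<close> and \<open>a\<close> is deterministic. With
  \<open>\<Delta> = \<Sum>\<^sub>i\<^sub>j |H\<^sub>i\<^sub>j - \<delta>\<^sub>i\<^sub>j|\<close>, Cauchy-Schwarz gives \<open>SINR \<le> a (1 + \<Delta>)\<close> and a perturbation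
  argument gives \<open>a (1 - \<Delta>) \<le> SINR\<close>; the latter is trivial if \<open>\<Delta> \<ge> 1\<close>, so singular
  matrices need no separate probability estimate. By concavity of \<open>ln\<close>,
  \<open>|ln (1 + SINR) - ln (1 + a)| \<le> \<Delta> (1 + ln (1 + a))\<close> pointwise. The entries of \<open>H\<close> are
  averages of \<open>M\<close> uncorrelated terms of bounded variance, so the expectation of \<open>\<Delta>\<close> is
  \<open>O(1 / sqrt M)\<close>, while \<open>ln (1 + a) = O(ln M)\<close>.
\<close>

section \<open>Zero forcing and the Gram matrix\<close>

lemma mult_mat_index:
  assumes "A \<in> carrier_mat n l" "B \<in> carrier_mat l p" "i < n" "k < p"
  shows "(A * B) $$ (i, k) = (\<Sum>j<l. A $$ (i, j) * B $$ (j, k))"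
  using assms by (simp add: scalar_prod_def atLeast0LessThan)

lemma mult_mat_vec_index:
  assumes "A \<in> carrier_mat n l" "v \<in> carrier_vec l" "i < n"
  shows "vec_index (A *\<^sub>v v) i = (\<Sum>j<l. A $$ (i, j) * vec_index v j)"
  using assms by (simp add: scalar_prod_def atLeast0LessThan)

lemma mat_inverse_None_det:
  fixes A :: "'a::field mat"
  assumes A: "A \<in> carrier_mat n n" and "mat_inverse A = None"
  shows "Determinant.det A = 0"
  using mat_inverse(1)[OF A, where b = "()"] det_non_zero_imp_unit[OF A, where b = "()"] assms(2)
  by blast

lemma gram_carrier:
  fixes G :: "complex mat"
  assumes "G \<in> carrier_mat M K"
  shows "mat_adjoint G * G \<in> carrier_mat K K"
  using assms by (auto simp: mat_adjoint_def)

lemma gram_index: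
  fixes G :: "complex mat"
  assumes "G \<in> carrier_mat M K" "i < K" "j < K"
  shows "(mat_adjoint G * G) $$ (i, j) = (\<Sum>m<M. cnj (G $$ (m, i)) * G $$ (m, j))"
proof -
  have "dim_row (mat_adjoint G) = K" "row (mat_adjoint G) i = conjugate (col G i)"
    using assms unfolding mat_adjoint_def by auto
  then show ?thesis
    using assms by (simp add: scalar_prod_def atLeast0LessThan)
qed

text \<open>Write \<open>A\<close> for the Gram matrix, so that \<open>a = G B e\<^sub>k\<close>.
  The products of \<open>a\<close> with the columns of \<open>G\<close> are the conjugates of the
  entries in column \<open>k\<close> of \<open>A * B = 1\<close>, which makes \<open>a\<close>
  orthogonal to every interferer. Expanding just one factor of the squared norm through
  \<open>a = G B e\<^sub>k\<close> reduces the norm to these products, and only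
  \<open>B $$ (k, k)\<close> survives.\<close>

lemma zf_detector_Some:
  assumes G: "G \<in> carrier_mat M K" and k: "k < K"
    and B: "mat_inverse (mat_adjoint G * G) = Some B"
  defines "a \<equiv> col (zf_detector G) k"
  shows "i < K \<Longrightarrow> herm_prod a (col G i) = (if i = k then 1 else 0)"
    and "complex_of_real (sq_norm_vec a) = B $$ (k, k)"
proof -
  let ?A = "mat_adjoint G * G"
  have AB: "?A * B = 1\<^sub>m K" "B \<in> carrier_mat K K"
    using mat_inverse(2)[OF gram_carrier[OF G] B] by auto
  have dim: "dim_vec a = M"
    using G by (simp add: a_def zf_detector_def B)
  have a: "vec_index a m = (\<Sum>j<K. G $$ (m, j) * B $$ (j, k))" if "m < M" for m
    using that G AB(2) k by (simp add: a_def zf_detector_def B scalar_prod_def atLeast0LessThan)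
  have hp: "herm_prod a (col G i) = (\<Sum>m<M. cnj (vec_index a m) * G $$ (m, i))" if "i < K" for i
    using that G dim by (simp add: herm_prod_def scalar_prod_def atLeast0LessThan)
  have orth: "herm_prod a (col G i) = (if i = k then 1 else 0)" if i: "i < K" for i
  proof -
    have "cnj (herm_prod a (col G i)) = (\<Sum>m<M. vec_index a m * cnj (G $$ (m, i)))"
      by (simp add: hp[OF i])
    also have "\<dots> = (\<Sum>m<M. \<Sum>j<K. cnj (G $$ (m, i)) * G $$ (m, j) * B $$ (j, k))"
      by (intro sum.cong) (auto simp: a sum_distrib_left sum_distrib_right mult_ac)
    also have "\<dots> = (\<Sum>j<K. (\<Sum>m<M. cnj (G $$ (m, i)) * G $$ (m, j)) * B $$ (j, k))"
      by (subst sum.swap) (simp add: sum_distrib_right)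
    also have "\<dots> = (\<Sum>j<K. ?A $$ (i, j) * B $$ (j, k))"
      using gram_index[OF G i] by (intro sum.cong) auto
    also have "\<dots> = (?A * B) $$ (i, k)"
      by (rule mult_mat_index[OF gram_carrier[OF G] AB(2) i k, symmetric])
    also have "\<dots> = (if i = k then 1 else 0)"
      using i k by (simp add: AB(1))
    finally have "cnj (cnj (herm_prod a (col G i))) = cnj (if i = k then 1 else 0)"
      by simp
    then show ?thesis by (simp split: if_splits)
  qed
  then show "i < K \<Longrightarrow> herm_prod a (col G i) = (if i = k then 1 else 0)" .
  have "complex_of_real (sq_norm_vec a) = (\<Sum>m<M. cnj (vec_index a m) * vec_index a m)"
    unfolding sq_norm_vec_def dim of_real_sum
    by (intro sum.cong) (simp_all only: complex_norm_square mult.commute)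
  also have "\<dots> = (\<Sum>m<M. \<Sum>j<K. cnj (vec_index a m) * (G $$ (m, j) * B $$ (j, k)))"
    by (intro sum.cong refl) (subst (2) a, auto simp: sum_distrib_left)
  also have "\<dots> = (\<Sum>j<K. herm_prod a (col G j) * B $$ (j, k))"
    by (subst sum.swap) (simp add: sum_distrib_left sum_distrib_right hp mult_ac)
  also have "\<dots> = (\<Sum>j<K. (if j = k then B $$ (j, k) else 0))"
    by (intro sum.cong) (auto simp: orth)
  also have "\<dots> = B $$ (k, k)" using k by simp
  finally show "complex_of_real (sq_norm_vec a) = B $$ (k, k)" .
qed

text \<open>The factor of the squared detector norm in the denominator of \<open>sinr\<close>: the
  power of the estimation and aging errors of all users plus unit receiver noise. Under zero forcing
  it is the only disturbance left.\<close>

definition noise_level :: "nat \<Rightarrow> real \<Rightarrow> real \<Rightarrow> real \<Rightarrow> (nat \<Rightarrow> real) \<Rightarrow> real" where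
  "noise_level K pu pp \<alpha> \<beta> =
     pu * (\<Sum>i<K. \<beta> i - \<alpha>\<^sup>2 * (pp * (\<beta> i)\<^sup>2 / (1 + pp * \<beta> i))) + 1"

lemma sinr_zf_Some:
  assumes G: "G \<in> carrier_mat M K" and k: "k < K"
    and B: "mat_inverse (mat_adjoint G * G) = Some B"
  shows "sinr K pu pp \<alpha> \<beta> G (col (zf_detector G) k) k
           = pu / (Re (B $$ (k, k)) * noise_level K pu pp \<alpha> \<beta>)"
proof -
  have "(\<Sum>i\<in>{..<K} - {k}. (cmod (herm_prod (col (zf_detector G) k) (col G i)))\<^sup>2) = 0"
    by (rule sum.neutral) (use zf_detector_Some(1)[OF G k B] in auto)
  moreover have "Re (B $$ (k, k)) = sq_norm_vec (col (zf_detector G) k)"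
    by (simp flip: zf_detector_Some(2)[OF G k B])
  ultimately show ?thesis
    using zf_detector_Some(1)[OF G k B k] by (simp add: sinr_def noise_level_def)
qed

text \<open>With the default detector 0, both numerator and denominator of \<open>sinr\<close>
  vanish, and 0 / 0 is 0 in HOL.\<close>

lemma sinr_zf_None:
  assumes G: "G \<in> carrier_mat M K" and k: "k < K"
    and "mat_inverse (mat_adjoint G * G) = None"
  shows "sinr K pu pp \<alpha> \<beta> G (col (zf_detector G) k) k = 0"
proof -
  have "col (zf_detector G) k = 0\<^sub>v M"
    using assms by (simp add: zf_detector_def)
  then show ?thesis
    using assms by (simp add: sinr_def herm_prod_def conjugate_zero_vec)
qed

text \<open>Prepares measurability: \<open>mat_inverse\<close> comes from an elimination procedure,
  whereas determinants and cofactors are polynomials in the matrix entries. The singular case is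
  expressed by a determinant test as well.\<close>

lemma sinr_zf_eq_cofactor:
  assumes G: "G \<in> carrier_mat M K" and k: "k < K"
  defines "A \<equiv> mat_adjoint G * G"
  shows "sinr K pu pp \<alpha> \<beta> G (col (zf_detector G) k) k
           = (if Determinant.det A = 0 then 0
              else pu / (Re (cofactor A k k / Determinant.det A) * noise_level K pu pp \<alpha> \<beta>))"
proof -
  have A: "A \<in> carrier_mat K K" unfolding A_def by (rule gram_carrier[OF G])
  show ?thesis
  proof (cases "mat_inverse A")
    case None
    then have "Determinant.det A = 0" by (rule mat_inverse_None_det[OF A])
    then show ?thesis using sinr_zf_None[OF G k] None by (simp add: A_def)
  next
    case (Some B)
    then have AB: "A * B = 1\<^sub>m K" "B * A = 1\<^sub>m K" "B \<in> carrier_mat K K"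
      using mat_inverse(2)[OF A] by auto
    have "Determinant.det A * Determinant.det B = 1"
      using det_mult[OF A AB(3)] AB(1) by simp
    then have nz: "Determinant.det A \<noteq> 0" by auto
    \<comment> \<open>Cramer's rule: inserting \<open>B * A = 1\<close> and regrouping brings in the
      identity for \<open>A * adj_mat A\<close>. On the diagonal the transposition inside
      \<open>adj_mat\<close> makes no difference.\<close>
    have "adj_mat A = (B * A) * adj_mat A"
      using AB adj_mat(1)[OF A] by simp
    also have "\<dots> = B * (A * adj_mat A)"
      by (rule assoc_mult_mat[OF AB(3) A adj_mat(1)[OF A]])
    also have "\<dots> = Determinant.det A \<cdot>\<^sub>m B"
      using AB(3) by (simp add: adj_mat(2)[OF A] mult_smult_distrib[OF AB(3) one_carrier_mat])
    finally have "adj_mat A $$ (k, k) = Determinant.det A * B $$ (k, k)"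
      using AB(3) k by simp
    then have "B $$ (k, k) = cofactor A k k / Determinant.det A"
      using nz A k by (simp add: adj_mat_def)
    then show ?thesis using sinr_zf_Some[OF G k] Some nz by (simp add: A_def)
  qed
qed

text \<open>Entrywise distance to the identity of the Gram matrix after column \<open>i\<close> of
  \<open>G\<close> is scaled by \<open>1 / d i\<close> and the result is averaged over the antennas.
  Later \<open>d i\<close> is, up to sign, the standard deviation of the CSI entries of user
  \<open>i\<close>, so the scaled matrix has mean identity.\<close>

definition gram_deviation :: "nat \<Rightarrow> nat \<Rightarrow> (nat \<Rightarrow> real) \<Rightarrow> complex mat \<Rightarrow> real" where
  "gram_deviation M K d G =
     (\<Sum>i<K. \<Sum>j<K. cmod ((\<Sum>m<M. cnj (G $$ (m, i)) * G $$ (m, j)) / of_real (real M * d i * d j)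
                             - (if i = j then 1 else 0)))"

text \<open>Read row \<open>i\<close> of the system, with \<open>i\<close> an index at which
  \<open>cmod (y i)\<close> is largest: \<open>y i\<close> equals \<open>c i\<close> minus a
  perturbation of size at most \<Delta> times that maximum. No invertibility of \<open>h\<close> is
  assumed, so the bound applies both to a kernel vector (\<open>c = 0\<close>) and to a column of
  the inverse (\<open>c\<close> a unit vector). For \<Delta> > 1 the left-hand side is
  nonpositive.\<close>

lemma near_identity_solution_bound:
  fixes h :: "nat \<Rightarrow> nat \<Rightarrow> complex" and y c :: "nat \<Rightarrow> complex"
  assumes eq: "\<And>i. i < K \<Longrightarrow> (\<Sum>j<K. h i j * y j) = c i"
    and c: "\<And>i. i < K \<Longrightarrow> cmod (c i) \<le> r" and k: "k < K"
  defines "\<Delta> \<equiv> (\<Sum>i<K. \<Sum>j<K. cmod (h i j - (if i = j then 1 else 0)))"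
  shows "(1 - \<Delta>) * cmod (y k) \<le> r"
proof -
  define \<rho> where "\<rho> = Max ((\<lambda>i. cmod (y i)) ` {..<K})"
  have le_\<rho>: "cmod (y i) \<le> \<rho>" if "i < K" for i
    unfolding \<rho>_def using that by (intro Max_ge) auto
  have "\<rho> \<in> (\<lambda>i. cmod (y i)) ` {..<K}"
    unfolding \<rho>_def using k by (intro Max_in) auto
  then obtain i where i: "i < K" "\<rho> = cmod (y i)" by auto
  have "(\<Sum>j<K. (h i j - (if i = j then 1 else 0)) * y j)
          = (\<Sum>j<K. h i j * y j) - (\<Sum>j<K. if i = j then y j else 0)"
    unfolding sum_subtractf[symmetric] by (intro sum.cong) (auto simp: algebra_simps)
  also have "\<dots> = c i - y i" using eq[OF i(1)] i(1) by simp
  finally have "cmod (y i) = cmod (c i - (\<Sum>j<K. (h i j - (if i = j then 1 else 0)) * y j))"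
    by simp
  also have "\<dots> \<le> cmod (c i) + (\<Sum>j<K. cmod ((h i j - (if i = j then 1 else 0)) * y j))"
    by (rule order_trans[OF norm_triangle_ineq4]) (intro add_left_mono norm_sum)
  also have "\<dots> \<le> r + (\<Sum>j<K. cmod (h i j - (if i = j then 1 else 0)) * \<rho>)"
    unfolding norm_mult using c[OF i(1)] le_\<rho> by (intro add_mono sum_mono mult_left_mono) auto
  also have "\<dots> \<le> r + \<Delta> * \<rho>"
  proof -
    have "(\<Sum>j<K. cmod (h i j - (if i = j then 1 else 0))) \<le> \<Delta>"
      unfolding \<Delta>_def using i(1)
      by (intro member_le_sum[where f = "\<lambda>i. \<Sum>j<K. cmod (h i j - (if i = j then 1 else 0))"])
         (auto intro: sum_nonneg)
    moreover have "\<rho> \<ge> 0" by (simp add: i(2))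
    ultimately show ?thesis
      unfolding sum_distrib_right[symmetric] by (intro add_left_mono mult_right_mono)
  qed
  finally have main: "(1 - \<Delta>) * \<rho> \<le> r" using i(2) by (simp add: algebra_simps)
  have r: "0 \<le> r" using c[OF k] norm_ge_zero[of "c k"] by linarith
  show ?thesis
  proof (cases "\<Delta> \<le> 1")
    case True
    then have "(1 - \<Delta>) * cmod (y k) \<le> (1 - \<Delta>) * \<rho>"
      using le_\<rho>[OF k] by (intro mult_left_mono) auto
    then show ?thesis using main by linarith
  next
    case False
    then have "(1 - \<Delta>) * cmod (y k) \<le> 0" by (intro mult_nonpos_nonneg) auto
    then show ?thesis using r by linarith
  qed
qed

text \<open>Here \<open>a\<close> is the value the SINR would have if the scaled Gram matrix were
  exactly the identity. In the invertible case \<open>t = a / cmod (y k)\<close> for the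
  \<open>y\<close> of the proof, so the lower bound on \<open>t\<close> is an upper bound on
  \<open>y k\<close>, from the perturbation lemma, and the upper bound on \<open>t\<close> is a
  lower bound on \<open>y k\<close>, from Cauchy-Schwarz.\<close>

lemma sinr_zf_bounds:
  assumes G: "G \<in> carrier_mat M K" and k: "k < K" and M: "0 < M"
    and d: "\<And>i. i < K \<Longrightarrow> d i \<noteq> 0"
    and pu: "0 < pu" and N: "0 < noise_level K pu pp \<alpha> \<beta>"
  defines "a \<equiv> pu * real M * (d k)\<^sup>2 / noise_level K pu pp \<alpha> \<beta>"
    and "t \<equiv> sinr K pu pp \<alpha> \<beta> G (col (zf_detector G) k) k"
    and "\<Delta> \<equiv> gram_deviation M K d G"
  shows "a * (1 - \<Delta>) \<le> t" and "t \<le> a * (1 + \<Delta>)" and "0 \<le> t"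
proof -
  let ?N = "noise_level K pu pp \<alpha> \<beta>"
  define h where "h i j = (\<Sum>m<M. cnj (G $$ (m, i)) * G $$ (m, j)) / complex_of_real (real M * d i * d j)" for i j
  have \<Delta>: "\<Delta> = (\<Sum>i<K. \<Sum>j<K. cmod (h i j - (if i = j then 1 else 0)))"
    by (simp add: \<Delta>_def gram_deviation_def h_def)
  have \<Delta>0: "0 \<le> \<Delta>" unfolding \<Delta> by (intro sum_nonneg) auto
  have a: "0 < a" using pu N M d[OF k] by (simp add: a_def)
  let ?A = "mat_adjoint G * G"
  have A: "?A \<in> carrier_mat K K" by (rule gram_carrier[OF G])
  have h: "h i j = ?A $$ (i, j) / complex_of_real (real M * d i * d j)" if "i < K" "j < K" for i j
    using gram_index[OF G that] by (simp add: h_def)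
  have "a * (1 - \<Delta>) \<le> t \<and> t \<le> a * (1 + \<Delta>) \<and> 0 \<le> t"
  proof (cases "mat_inverse ?A")
    case None
    then have "Determinant.det ?A = 0" by (rule mat_inverse_None_det[OF A])
    \<comment> \<open>A kernel vector of the Gram matrix, rescaled coordinatewise by
      \<open>d\<close>, is a kernel vector of \<open>h\<close>. A nonzero coordinate
      \<open>l\<close> then forces \<Delta> \<ge> 1, which makes the lower bound nonpositive, in
      agreement with \<open>t = 0\<close>.\<close>
    then obtain v where v: "v \<in> carrier_vec K" "v \<noteq> 0\<^sub>v K" "?A *\<^sub>v v = 0\<^sub>v K"
      using det_0_iff_vec_prod_zero[OF A] by blast
    obtain l where l: "l < K" "vec_index v l \<noteq> 0"
      using v(1,2) by (metis carrier_vecD eq_vecI index_zero_vec(1,2))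
    have "(\<Sum>j<K. h i j * (of_real (d j) * vec_index v j)) = 0" if i: "i < K" for i
    proof -
      have "(\<Sum>j<K. ?A $$ (i, j) * vec_index v j) = vec_index (?A *\<^sub>v v) i"
        by (rule mult_mat_vec_index[OF A v(1) i, symmetric])
      then have "(\<Sum>j<K. ?A $$ (i, j) * vec_index v j) = 0" using v(3) i by simp
      moreover have "(\<Sum>j<K. h i j * (of_real (d j) * vec_index v j))
          = (\<Sum>j<K. ?A $$ (i, j) * vec_index v j) / of_real (real M * d i)"
        unfolding sum_divide_distrib using d M i by (intro sum.cong) (auto simp: h field_simps)
      ultimately show ?thesis by simp
    qed
    then have "(1 - \<Delta>) * cmod (of_real (d l) * vec_index v l) \<le> 0"
      unfolding \<Delta> by (intro near_identity_solution_bound[where c = "\<lambda>_. 0"]) (use l in auto)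
    moreover have "cmod (of_real (d l) * vec_index v l) > 0" using l d by simp
    ultimately have "1 - \<Delta> \<le> 0" by (simp add: mult_le_0_iff)
    moreover have "t = 0" unfolding t_def by (rule sinr_zf_None[OF G k None])
    ultimately show ?thesis using a \<Delta>0 by (simp add: mult_nonneg_nonpos)
  next
    case (Some B)
    have AB: "?A * B = 1\<^sub>m K" "B \<in> carrier_mat K K"
      using mat_inverse(2)[OF A Some] by auto
    define v where "v = col (zf_detector G) k"
    define b where "b = sq_norm_vec v"
    have Bkk: "B $$ (k, k) = of_real b"
      using zf_detector_Some(2)[OF G k Some] by (simp add: b_def v_def)
    have b0: "0 \<le> b" by (simp add: b_def sq_norm_vec_def sum_nonneg)
    have tb: "t = pu / (b * ?N)"
      using sinr_zf_Some[OF G k Some] by (simp add: t_def Bkk)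
    \<comment> \<open>Column \<open>k\<close> of the inverse of \<open>h\<close>: dividing entry (i,
      j) of the Gram matrix by \<open>M d\<^sub>i d\<^sub>j\<close> multiplies entry (j, k) of its
      inverse by \<open>M d\<^sub>j d\<^sub>k\<close>.\<close>
    define y where "y j = of_real (real M * d j * d k) * B $$ (j, k)" for j
    have "(\<Sum>j<K. h i j * y j) = (if i = k then 1 else 0)" if i: "i < K" for i
    proof -
      have "(\<Sum>j<K. ?A $$ (i, j) * B $$ (j, k)) = (?A * B) $$ (i, k)"
        by (rule mult_mat_index[OF A AB(2) i k, symmetric])
      then have "(\<Sum>j<K. ?A $$ (i, j) * B $$ (j, k)) = (if i = k then 1 else 0)"
        using AB(1) i k by simp
      moreover have "(\<Sum>j<K. h i j * y j)
          = (\<Sum>j<K. ?A $$ (i, j) * B $$ (j, k)) * of_real (d k / d i)"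
        unfolding sum_distrib_right y_def using d M i by (intro sum.cong) (auto simp: h field_simps)
      ultimately show ?thesis using d i by auto
    qed
    then have "(1 - \<Delta>) * cmod (y k) \<le> 1"
      unfolding \<Delta> by (intro near_identity_solution_bound) (use k in auto)
    moreover have yk: "cmod (y k) = real M * (d k)\<^sup>2 * b"
      using b0 by (simp add: y_def Bkk norm_mult power2_eq_square)
    ultimately have lower: "(1 - \<Delta>) * (real M * (d k)\<^sup>2 * b) \<le> 1" by simp
    have dim: "dim_vec v = M"
      using G by (simp add: v_def zf_detector_def Some)
    \<comment> \<open>Unit gain towards user \<open>k\<close> and Cauchy-Schwarz bound the detector
      norm \<open>b\<close> from below. This also gives \<open>b > 0\<close>, which the later
      cancellations use.\<close>
    have "1 = cmod (herm_prod v (col G k))"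
      using zf_detector_Some(1)[OF G k Some k] by (simp add: v_def)
    also have "\<dots> \<le> (\<Sum>m<M. cmod (vec_index v m) * cmod (G $$ (m, k)))"
      using G k dim unfolding herm_prod_def
      by (auto simp: scalar_prod_def atLeast0LessThan norm_mult intro!: order_trans[OF norm_sum])
    finally have "1 \<le> (\<Sum>m<M. cmod (vec_index v m) * cmod (G $$ (m, k)))\<^sup>2"
      by simp
    also have "\<dots> \<le> b * (\<Sum>m<M. (cmod (G $$ (m, k)))\<^sup>2)"
      using Cauchy_Schwarz_ineq_sum[of "\<lambda>m. cmod (vec_index v m)" "\<lambda>m. cmod (G $$ (m, k))" "{..<M}"]
      by (simp add: b_def sq_norm_vec_def dim)
    finally have cs: "1 \<le> b * (\<Sum>m<M. (cmod (G $$ (m, k)))\<^sup>2)" .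
    then have b: "0 < b" using b0 by (cases "b = 0") auto
    have "cmod (h k k - 1) \<le> (\<Sum>j<K. cmod (h k j - (if k = j then 1 else 0)))"
      using member_le_sum[of k "{..<K}" "\<lambda>j. cmod (h k j - (if k = j then 1 else 0))"] k by simp
    also have "\<dots> \<le> \<Delta>" unfolding \<Delta>
      using member_le_sum[of k "{..<K}" "\<lambda>i. \<Sum>j<K. cmod (h i j - (if i = j then 1 else 0))"] k
      by (simp add: sum_nonneg)
    finally have hkk: "Re (h k k) \<le> 1 + \<Delta>"
      using complex_Re_le_cmod[of "h k k - 1"] by simp
    have "h k k = of_real ((\<Sum>m<M. (cmod (G $$ (m, k)))\<^sup>2) / (real M * (d k)\<^sup>2))"
      unfolding h_def of_real_divide of_real_sum complex_norm_square
      by (simp add: power2_eq_square mult_ac)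
    then have "Re (h k k) = (\<Sum>m<M. (cmod (G $$ (m, k)))\<^sup>2) / (real M * (d k)\<^sup>2)" by simp
    with hkk have upper: "(\<Sum>m<M. (cmod (G $$ (m, k)))\<^sup>2) \<le> (1 + \<Delta>) * (real M * (d k)\<^sup>2)"
      using M d[OF k] by (simp add: field_simps)
    have "1 \<le> b * ((1 + \<Delta>) * (real M * (d k)\<^sup>2))"
      using cs mult_left_mono[OF upper b0] by linarith
    then have "pu * 1 \<le> pu * (b * ((1 + \<Delta>) * (real M * (d k)\<^sup>2)))"
      using pu by (intro mult_left_mono) auto
    then have "t \<le> a * (1 + \<Delta>)"
      using b N by (simp add: tb a_def field_simps)
    moreover have "a * (1 - \<Delta>) \<le> t"
    proof -
      have "pu * ((1 - \<Delta>) * (real M * (d k)\<^sup>2 * b)) \<le> pu * 1"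
        using pu lower by (intro mult_left_mono) auto
      then have "pu * ((1 - \<Delta>) * (real M * (d k)\<^sup>2 * b)) / (b * ?N) \<le> pu / (b * ?N)"
        using b N by (intro divide_right_mono) auto
      moreover have "pu * ((1 - \<Delta>) * (real M * (d k)\<^sup>2 * b)) / (b * ?N) = a * (1 - \<Delta>)"
        using b N by (simp add: a_def field_simps)
      ultimately show ?thesis by (simp add: tb)
    qed
    moreover have "0 \<le> t" using b N pu by (simp add: tb)
    ultimately show ?thesis by blast
  qed
  then show "a * (1 - \<Delta>) \<le> t" "t \<le> a * (1 + \<Delta>)" "0 \<le> t" by auto
qed

text \<open>Above: \<open>1 + t\<close> is at most \<open>(1 + a) * (1 + \<Delta>)\<close>, and the
  second factor contributes at most \<Delta> to the logarithm. Below: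
  \<open>1 + a * (1 - \<Delta>)\<close> is the convex combination of 1 and \<open>1 + a\<close> with
  weights \<Delta> and \<open>1 - \<Delta>\<close>, so concavity retains the fraction
  \<open>1 - \<Delta>\<close> of \<open>ln (1 + a)\<close>. The result is linear in \<Delta>, so a
  first moment of \<Delta> suffices even when \<open>a\<close> is unbounded.\<close>

lemma concave_ln_bound:
  fixes a t \<Delta> :: real
  assumes "0 \<le> a" "0 \<le> \<Delta>" "a * (1 - \<Delta>) \<le> t" "t \<le> a * (1 + \<Delta>)" "0 \<le> t"
  shows "\<bar>ln (1 + t) - ln (1 + a)\<bar> \<le> \<Delta> * (1 + ln (1 + a))"
proof -
  have l0: "0 \<le> ln (1 + a)" using assms by simp
  have up: "ln (1 + t) - ln (1 + a) \<le> \<Delta>"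
  proof -
    have "1 + t \<le> (1 + a) * (1 + \<Delta>)" using assms by (simp add: algebra_simps)
    then have "ln (1 + t) \<le> ln ((1 + a) * (1 + \<Delta>))" using assms by (subst ln_le_cancel_iff) auto
    also have "\<dots> = ln (1 + a) + ln (1 + \<Delta>)" using assms by (simp add: ln_mult)
    finally show ?thesis using ln_add_one_self_le_self[of \<Delta>] assms by linarith
  qed
  have lo: "ln (1 + a) * (1 - \<Delta>) \<le> ln (1 + t)"
  proof (cases "\<Delta> \<le> 1")
    case True
    have "ln (1 + a) * (1 - \<Delta>) = ln 1 * \<Delta> + ln (1 + a) * (1 - \<Delta>)" by simp
    also have "\<dots> \<le> ln (\<Delta> * 1 + (1 - \<Delta>) * (1 + a))"
      using concave_onD[OF ln_concave, of \<Delta> "1 + a" 1] assms True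
      by (simp add: mult.commute add.commute)
    also have "\<dots> \<le> ln (1 + t)"
    proof -
      have "0 \<le> a * (1 - \<Delta>)" using assms True by simp
      moreover have "\<Delta> * 1 + (1 - \<Delta>) * (1 + a) = 1 + a * (1 - \<Delta>)" by (simp add: algebra_simps)
      ultimately show ?thesis using assms by (subst ln_le_cancel_iff) auto
    qed
    finally show ?thesis .
  next
    case False
    then have "ln (1 + a) * (1 - \<Delta>) \<le> 0" using l0 by (intro mult_nonneg_nonpos) auto
    then show ?thesis using assms by (smt (verit) ln_ge_zero)
  qed
  have "0 \<le> \<Delta> * ln (1 + a)" using l0 assms by simp
  moreover have "\<Delta> * (1 + ln (1 + a)) = \<Delta> + \<Delta> * ln (1 + a)"
    "ln (1 + a) * (1 - \<Delta>) = ln (1 + a) - \<Delta> * ln (1 + a)"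
    by (simp_all add: algebra_simps)
  ultimately show ?thesis using up lo assms(2) by linarith
qed

section \<open>Moments of the complex normal law\<close>

lemma prob_space_std_normal_law: "prob_space std_normal_law"
  unfolding std_normal_law_def by (rule prob_space_normal_density) simp

lemma sets_std_normal_law [measurable_cong, simp]: "sets std_normal_law = sets borel"
  by (simp add: std_normal_law_def)

lemma space_std_normal_law [simp]: "space std_normal_law = UNIV"
  by (simp add: std_normal_law_def)

lemma std_normal_law_even_moment:
  "has_bochner_integral std_normal_law (\<lambda>x. x ^ (2 * n)) (fact (2 * n) / (2 ^ n * fact n))"
  unfolding std_normal_law_def
  by (rule has_bochner_integral_density) (use std_normal_moment_even[of n] in auto)

lemma std_normal_law_odd_moment:
  "has_bochner_integral std_normal_law (\<lambda>x. x ^ (2 * n + 1)) 0"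
  unfolding std_normal_law_def
  by (rule has_bochner_integral_density) (use std_normal_moment_odd[of n] in auto)

text \<open>The marginals of a product of probability measures are its factors, so the
  one-dimensional Gaussian moments carry over to the real and imaginary parts on the product
  space.\<close>

lemma
  fixes f :: "'a \<Rightarrow> 'c::{banach, second_countable_topology}" and N1 :: "'a measure" and N2 :: "'b measure"
  assumes "prob_space N1" "prob_space N2"
    and "has_bochner_integral N1 f c"
  shows has_bochner_integral_pair_fst: "has_bochner_integral (N1 \<Otimes>\<^sub>M N2) (\<lambda>p. f (fst p)) c"
    and has_bochner_integral_pair_snd: "has_bochner_integral (N2 \<Otimes>\<^sub>M N1) (\<lambda>p. f (snd p)) c"
proof -
  interpret N1: prob_space N1 by fact
  interpret N2: prob_space N2 by fact
  interpret P: pair_prob_space N2 N1 ..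
  have f: "f \<in> borel_measurable N1" "integrable N1 f" "integral\<^sup>L N1 f = c"
    using assms(3) by (auto simp: has_bochner_integral_iff)
  have fst: "distr (N1 \<Otimes>\<^sub>M N2) N1 fst = N1" by (rule N2.distr_pair_fst)
  have snd: "distr (N2 \<Otimes>\<^sub>M N1) N1 snd = N1"
  proof -
    have "distr (N2 \<Otimes>\<^sub>M N1) N1 snd = distr (N1 \<Otimes>\<^sub>M N2) N1 (snd \<circ> (\<lambda>(x, y). (y, x)))"
      by (subst P.distr_pair_swap) (rule distr_distr, auto)
    also have "snd \<circ> (\<lambda>(x, y). (y, x)) = fst" by auto
    finally show ?thesis using fst by simp
  qed
  show "has_bochner_integral (N1 \<Otimes>\<^sub>M N2) (\<lambda>p. f (fst p)) c"
    using integrable_distr_eq[OF measurable_fst[of N1 N2] f(1)] integral_distr[OF measurable_fst[of N1 N2] f(1)] f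
    by (simp add: has_bochner_integral_iff fst)
  show "has_bochner_integral (N2 \<Otimes>\<^sub>M N1) (\<lambda>p. f (snd p)) c"
    using integrable_distr_eq[OF measurable_snd[of N2 N1] f(1)] integral_distr[OF measurable_snd[of N2 N1] f(1)] f
    by (simp add: has_bochner_integral_iff snd)
qed

text \<open>Everything is pulled back to the pair of standard normals. The exact fourth moment is
  \<open>2 * v\<^sup>2\<close>; the cruder constant 3 comes from
  \<open>(x\<^sup>2 + y\<^sup>2)\<^sup>2 \<le> 2 * (x ^ 4 + y ^ 4)\<close>, which avoids the mixed
  moment of the two components.\<close>

lemma
  assumes v: "0 \<le> v"
  shows complex_normal_law_mean: "has_bochner_integral (complex_normal_law v) (\<lambda>z. z) 0"
    and complex_normal_law_second_moment:
      "has_bochner_integral (complex_normal_law v) (\<lambda>z. (cmod z)\<^sup>2) v"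
    and complex_normal_law_fourth_moment_integrable:
      "integrable (complex_normal_law v) (\<lambda>z. (cmod z) ^ 4)"
    and complex_normal_law_fourth_moment_le:
      "(\<integral>z. (cmod z) ^ 4 \<partial>complex_normal_law v) \<le> 3 * v\<^sup>2"
proof -
  let ?P = "std_normal_law \<Otimes>\<^sub>M std_normal_law"
  let ?f = "\<lambda>(x, y). complex_of_real (sqrt (v / 2)) * Complex x y"
  note fst = has_bochner_integral_pair_fst[OF prob_space_std_normal_law prob_space_std_normal_law]
  note snd = has_bochner_integral_pair_snd[OF prob_space_std_normal_law prob_space_std_normal_law]
  have f_eq: "?f = (\<lambda>p. complex_of_real (sqrt (v / 2)) * (of_real (fst p) + \<i> * of_real (snd p)))"
    by (auto simp: fun_eq_iff complex_eq_iff)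
  have fm [measurable]: "?f \<in> measurable ?P borel"
    unfolding f_eq by measurable
  have cm: "(cmod (?f p))\<^sup>2 = v / 2 * ((fst p)\<^sup>2 + (snd p)\<^sup>2)" for p
    using v by (cases p) (simp add: norm_mult power_mult_distrib cmod_power2)
  have m1: "has_bochner_integral ?P fst 0" "has_bochner_integral ?P snd 0"
    using fst[OF std_normal_law_odd_moment[of 0]] snd[OF std_normal_law_odd_moment[of 0]] by simp_all
  have m2: "has_bochner_integral ?P (\<lambda>p. (fst p)\<^sup>2) 1" "has_bochner_integral ?P (\<lambda>p. (snd p)\<^sup>2) 1"
    using fst[OF std_normal_law_even_moment[of 1]] snd[OF std_normal_law_even_moment[of 1]] by simp_all
  have m4: "has_bochner_integral ?P (\<lambda>p. (fst p) ^ 4) 3" "has_bochner_integral ?P (\<lambda>p. (snd p) ^ 4) 3"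
    using fst[OF std_normal_law_even_moment[of 2]] snd[OF std_normal_law_even_moment[of 2]]
    by (simp_all add: fact_numeral)
  have "has_bochner_integral ?P
     (\<lambda>p. complex_of_real (sqrt (v / 2)) * (of_real (fst p) + \<i> * of_real (snd p)))
     (complex_of_real (sqrt (v / 2)) * (of_real 0 + \<i> * of_real 0))"
    by (intro has_bochner_integral_mult_right has_bochner_integral_add has_bochner_integral_of_real m1)
  then show "has_bochner_integral (complex_normal_law v) (\<lambda>z. z) 0"
    unfolding complex_normal_law_def
    by (intro has_bochner_integral_distr) (auto simp: f_eq)
  have "has_bochner_integral ?P (\<lambda>p. v / 2 * ((fst p)\<^sup>2 + (snd p)\<^sup>2)) (v / 2 * (1 + 1))"
    by (intro has_bochner_integral_mult_right has_bochner_integral_add m2)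
  then show "has_bochner_integral (complex_normal_law v) (\<lambda>z. (cmod z)\<^sup>2) v"
    unfolding complex_normal_law_def
    by (intro has_bochner_integral_distr) (simp_all add: cm)
  have dom: "has_bochner_integral ?P (\<lambda>p. v\<^sup>2 / 2 * ((fst p) ^ 4 + (snd p) ^ 4)) (v\<^sup>2 / 2 * (3 + 3))"
    by (intro has_bochner_integral_mult_right has_bochner_integral_add m4)
  have le: "(cmod (?f p)) ^ 4 \<le> v\<^sup>2 / 2 * ((fst p) ^ 4 + (snd p) ^ 4)" for p
  proof -
    have "(cmod (?f p)) ^ 4 = ((cmod (?f p))\<^sup>2)\<^sup>2" by simp
    also have "\<dots> = v\<^sup>2 / 4 * ((fst p)\<^sup>2 + (snd p)\<^sup>2)\<^sup>2"
      by (simp only: cm) (simp add: power_mult_distrib power_divide)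
    also have "\<dots> \<le> v\<^sup>2 / 4 * (2 * ((fst p) ^ 4 + (snd p) ^ 4))"
    proof (rule mult_left_mono)
      have "0 \<le> ((fst p)\<^sup>2 - (snd p)\<^sup>2)\<^sup>2" by simp
      then show "((fst p)\<^sup>2 + (snd p)\<^sup>2)\<^sup>2 \<le> 2 * ((fst p) ^ 4 + (snd p) ^ 4)"
        by (simp add: power2_eq_square power4_eq_xxxx algebra_simps)
    qed simp
    also have "\<dots> = v\<^sup>2 / 2 * ((fst p) ^ 4 + (snd p) ^ 4)" by simp
    finally show ?thesis .
  qed
  have int: "integrable ?P (\<lambda>p. (cmod (?f p)) ^ 4)"
    by (rule Bochner_Integration.integrable_bound[OF integrable.intros[OF dom]])
       (use le in \<open>auto intro!: AE_I2 order_trans[OF le] simp del: split_paired_All\<close>)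
  then show "integrable (complex_normal_law v) (\<lambda>z. (cmod z) ^ 4)"
    unfolding complex_normal_law_def by (subst integrable_distr_eq) auto
  have "(\<integral>z. (cmod z) ^ 4 \<partial>complex_normal_law v) = (\<integral>p. (cmod (?f p)) ^ 4 \<partial>?P)"
    unfolding complex_normal_law_def by (subst integral_distr) auto
  also have "\<dots> \<le> (\<integral>p. v\<^sup>2 / 2 * ((fst p) ^ 4 + (snd p) ^ 4) \<partial>?P)"
    by (rule integral_mono[OF int integrable.intros[OF dom] le])
  also have "\<dots> = 3 * v\<^sup>2"
    using has_bochner_integral_integral_eq[OF dom] by simp
  finally show "(\<integral>z. (cmod z) ^ 4 \<partial>complex_normal_law v) \<le> 3 * v\<^sup>2" .
qed

lemma (in prob_space)
  assumes X: "X \<in> borel_measurable M" and law: "distr M borel X = complex_normal_law v"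
    and v: "0 \<le> v"
  shows complex_normal_mean: "integrable M X" "expectation X = 0"
    and complex_normal_second_moment:
      "integrable M (\<lambda>\<omega>. (cmod (X \<omega>))\<^sup>2)" "expectation (\<lambda>\<omega>. (cmod (X \<omega>))\<^sup>2) = v"
    and complex_normal_fourth_moment:
      "integrable M (\<lambda>\<omega>. (cmod (X \<omega>)) ^ 4)" "expectation (\<lambda>\<omega>. (cmod (X \<omega>)) ^ 4) \<le> 3 * v\<^sup>2"
  using complex_normal_law_mean[OF v] complex_normal_law_second_moment[OF v]
    complex_normal_law_fourth_moment_integrable[OF v] complex_normal_law_fourth_moment_le[OF v]
  unfolding law[symmetric] has_bochner_integral_iff
  by (simp_all add: integrable_distr_eq[OF X] integral_distr[OF X])

section \<open>Empirical correlations\<close>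

lemma norm_add_sq_le: "(norm (u + v))\<^sup>2 \<le> 2 * (norm u)\<^sup>2 + 2 * (norm v)\<^sup>2"
  for u v :: "'a::real_normed_vector"
proof -
  have "(norm (u + v))\<^sup>2 \<le> (norm u + norm v)\<^sup>2"
    by (intro power_mono norm_triangle_ineq) auto
  moreover have "0 \<le> (norm u - norm v)\<^sup>2" by simp
  ultimately show ?thesis by (simp add: power2_eq_square algebra_simps)
qed

lemma norm_add_power4_le: "norm (u + v) ^ 4 \<le> 8 * norm u ^ 4 + 8 * norm v ^ 4"
  for u v :: "'a::real_normed_vector"
proof -
  have "norm (u + v) ^ 4 = ((norm (u + v))\<^sup>2)\<^sup>2" by simp
  also have "\<dots> \<le> (2 * (norm u)\<^sup>2 + 2 * (norm v)\<^sup>2)\<^sup>2"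
    by (intro power_mono norm_add_sq_le) auto
  also have "\<dots> \<le> 2 * (2 * (norm u)\<^sup>2)\<^sup>2 + 2 * (2 * (norm v)\<^sup>2)\<^sup>2"
    using norm_add_sq_le[of "2 * (norm u)\<^sup>2" "2 * (norm v)\<^sup>2"] by simp
  also have "\<dots> = 8 * norm u ^ 4 + 8 * norm v ^ 4" by (simp add: power_mult_distrib)
  finally show ?thesis .
qed

lemma borel_measurable_cnj [measurable]:
  "f \<in> borel_measurable M \<Longrightarrow> (\<lambda>x. cnj (f x)) \<in> borel_measurable M"
  by (rule measurable_compose[OF _ borel_measurable_continuous_onI[OF continuous_on_cnj[OF continuous_on_id]]])

lemma (in prob_space) indep_var_of_indep_vars:
  fixes X :: "'i \<Rightarrow> 'a \<Rightarrow> 'b::topological_space"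
  assumes indep: "indep_vars (\<lambda>_. borel) X I" and ij: "i \<in> I" "j \<in> I" "i \<noteq> j"
  shows "indep_var borel (X i) borel (X j)"
proof -
  have "indep_var borel ((\<lambda>f. f i) \<circ> (\<lambda>\<omega>. restrict (\<lambda>i. X i \<omega>) {i}))
                  borel ((\<lambda>f. f j) \<circ> (\<lambda>\<omega>. restrict (\<lambda>i. X i \<omega>) {j}))"
    using ij by (intro indep_var_compose[OF indep_var_restrict[OF indep]]) auto
  then show ?thesis by (simp add: comp_def)
qed

text \<open>Orthogonality removes the off-diagonal terms of the second moment of the sum, leaving at
  most \<open>n * C\<close>. The passage to the first moment uses the arithmetic-geometric mean
  inequality \<open>cmod S \<le> (sqrt n + (cmod S)\<^sup>2 / sqrt n) / 2\<close>, whose two terms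
  both have mean of order \<open>sqrt n\<close>.\<close>

lemma (in prob_space) expectation_norm_sum_le:
  fixes W :: "nat \<Rightarrow> 'a \<Rightarrow> complex"
  assumes meas: "\<And>m. m < n \<Longrightarrow> W m \<in> borel_measurable M"
    and sq: "\<And>m. m < n \<Longrightarrow> integrable M (\<lambda>\<omega>. (cmod (W m \<omega>))\<^sup>2)"
    and sq_le: "\<And>m. m < n \<Longrightarrow> expectation (\<lambda>\<omega>. (cmod (W m \<omega>))\<^sup>2) \<le> C"
    and orth: "\<And>m l. m < n \<Longrightarrow> l < n \<Longrightarrow> m \<noteq> l \<Longrightarrow>
      integrable M (\<lambda>\<omega>. W m \<omega> * cnj (W l \<omega>)) \<and> expectation (\<lambda>\<omega>. W m \<omega> * cnj (W l \<omega>)) = 0"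
    and n: "0 < n"
  shows "integrable M (\<lambda>\<omega>. cmod (\<Sum>m<n. W m \<omega>))"
    and "expectation (\<lambda>\<omega>. cmod (\<Sum>m<n. W m \<omega>)) \<le> sqrt n * (1 + C) / 2"
proof -
  let ?S = "\<lambda>\<omega>. \<Sum>m<n. W m \<omega>"
  have S [measurable]: "?S \<in> borel_measurable M" using meas by auto
  have expand: "(cmod (?S \<omega>))\<^sup>2 = (\<Sum>m<n. \<Sum>l<n. Re (W m \<omega> * cnj (W l \<omega>)))" for \<omega>
  proof -
    have "complex_of_real ((cmod (?S \<omega>))\<^sup>2) = (\<Sum>m<n. \<Sum>l<n. W m \<omega> * cnj (W l \<omega>))"
      by (simp only: complex_norm_square cnj_sum sum_product)
    then have "Re (complex_of_real ((cmod (?S \<omega>))\<^sup>2)) = (\<Sum>m<n. \<Sum>l<n. Re (W m \<omega> * cnj (W l \<omega>)))"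
      by (simp only: Re_sum)
    then show ?thesis by (simp only: Re_complex_of_real)
  qed
  have diag: "Re (W m \<omega> * cnj (W m \<omega>)) = (cmod (W m \<omega>))\<^sup>2" for m \<omega>
    by (simp only: complex_norm_square[symmetric] Re_complex_of_real)
  have int: "integrable M (\<lambda>\<omega>. Re (W m \<omega> * cnj (W l \<omega>)))" if "m < n" "l < n" for m l
  proof (cases "m = l")
    case True
    then show ?thesis using sq[OF that(1)] by (simp only: diag)
  next
    case False
    then show ?thesis using orth[OF that] by (intro integrable_Re) blast
  qed
  have int_S: "integrable M (\<lambda>\<omega>. (cmod (?S \<omega>))\<^sup>2)"
    unfolding expand using int by (intro Bochner_Integration.integrable_sum) auto
  have "expectation (\<lambda>\<omega>. (cmod (?S \<omega>))\<^sup>2)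
          = (\<Sum>m<n. \<Sum>l<n. expectation (\<lambda>\<omega>. Re (W m \<omega> * cnj (W l \<omega>))))"
    unfolding expand using int
    by (subst Bochner_Integration.integral_sum)
       (auto intro!: sum.cong Bochner_Integration.integral_sum Bochner_Integration.integrable_sum simp del: complex_mult_cnj times_complex.sel)
  also have "\<dots> = (\<Sum>m<n. \<Sum>l<n. if l = m then expectation (\<lambda>\<omega>. (cmod (W m \<omega>))\<^sup>2) else 0)"
  proof (intro sum.cong refl)
    fix m l assume "m \<in> {..<n}" "l \<in> {..<n}"
    then show "expectation (\<lambda>\<omega>. Re (W m \<omega> * cnj (W l \<omega>))) =
        (if l = m then expectation (\<lambda>\<omega>. (cmod (W m \<omega>))\<^sup>2) else 0)"
      using orth[of m l] integral_Re[of M "\<lambda>\<omega>. W m \<omega> * cnj (W l \<omega>)"]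
      by (cases "m = l") (auto simp only: diag lessThan_iff zero_complex.simps simp_thms split: if_splits)
  qed
  also have "\<dots> = (\<Sum>m<n. expectation (\<lambda>\<omega>. (cmod (W m \<omega>))\<^sup>2))"
    by (intro sum.cong) (auto simp: sum.delta)
  also have "\<dots> \<le> real n * C"
    using sum_mono[of "{..<n}" "\<lambda>m. expectation (\<lambda>\<omega>. (cmod (W m \<omega>))\<^sup>2)" "\<lambda>_. C"] sq_le by simp
  finally have ES: "expectation (\<lambda>\<omega>. (cmod (?S \<omega>))\<^sup>2) \<le> real n * C" .
  have amgm: "cmod (?S \<omega>) \<le> (sqrt n + (cmod (?S \<omega>))\<^sup>2 / sqrt n) / 2" for \<omega>
  proof -
    have s: "0 < sqrt n" using n by simp
    have "0 \<le> (sqrt n - cmod (?S \<omega>))\<^sup>2 / sqrt n" using s by simp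
    also have "\<dots> = sqrt n + (cmod (?S \<omega>))\<^sup>2 / sqrt n - 2 * cmod (?S \<omega>)"
      using s unfolding power2_diff by (simp add: field_simps power2_eq_square)
    finally show ?thesis by simp
  qed
  have int_b: "integrable M (\<lambda>\<omega>. (sqrt n + (cmod (?S \<omega>))\<^sup>2 / sqrt n) / 2)"
    using int_S by simp
  show int_abs: "integrable M (\<lambda>\<omega>. cmod (?S \<omega>))"
    by (rule Bochner_Integration.integrable_bound[OF int_b])
       (use amgm in \<open>auto intro!: AE_I2 order_trans[OF amgm]\<close>)
  have "expectation (\<lambda>\<omega>. cmod (?S \<omega>)) \<le> expectation (\<lambda>\<omega>. (sqrt n + (cmod (?S \<omega>))\<^sup>2 / sqrt n) / 2)"
    by (rule integral_mono[OF int_abs int_b amgm])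
  also have "\<dots> = (sqrt n + expectation (\<lambda>\<omega>. (cmod (?S \<omega>))\<^sup>2) / sqrt n) / 2"
    using int_S by (simp add: prob_space)
  also have "\<dots> \<le> (sqrt n + real n * C / sqrt n) / 2"
    using ES by (intro divide_right_mono add_left_mono) auto
  also have "\<dots> = sqrt n * (1 + C) / 2"
  proof -
    have "real n * C / sqrt n = C * (real n / sqrt n)" by simp
    also have "real n / sqrt n = sqrt n" by (rule real_div_sqrt) simp
    finally show ?thesis by (simp add: algebra_simps)
  qed
  finally show "expectation (\<lambda>\<omega>. cmod (?S \<omega>)) \<le> sqrt n * (1 + C) / 2" .
qed

text \<open>The summands \<open>W m\<close> are centered: for \<open>i = j\<close> because of unit
  variance, for \<open>i \<noteq> j\<close> because of independence and zero means. Different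
  antennas use disjoint sets of variables, so the summands are orthogonal. Their second moments are
  at most \<open>2 * C + 2\<close> by the fourth moments, and dividing the resulting bound on the
  sum by \<open>n\<close> gives the rate \<open>1 / sqrt n\<close>.\<close>

lemma (in prob_space) expectation_correlation_sum_le:
  fixes z :: "nat \<times> nat \<Rightarrow> 'a \<Rightarrow> complex"
  assumes indep: "indep_vars (\<lambda>_. borel) z ({..<K} \<times> {..<n})"
    and int: "\<And>p. p \<in> {..<K} \<times> {..<n} \<Longrightarrow> integrable M (z p)"
    and mean: "\<And>p. p \<in> {..<K} \<times> {..<n} \<Longrightarrow> expectation (z p) = 0"
    and var: "\<And>p. p \<in> {..<K} \<times> {..<n} \<Longrightarrow> expectation (\<lambda>\<omega>. (cmod (z p \<omega>))\<^sup>2) = 1"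
    and int4: "\<And>p. p \<in> {..<K} \<times> {..<n} \<Longrightarrow> integrable M (\<lambda>\<omega>. (cmod (z p \<omega>)) ^ 4)"
    and kurt: "\<And>p. p \<in> {..<K} \<times> {..<n} \<Longrightarrow> expectation (\<lambda>\<omega>. (cmod (z p \<omega>)) ^ 4) \<le> C"
    and i: "i < K" and j: "j < K" and n: "0 < n"
  defines "D \<equiv> \<lambda>\<omega>. cmod ((\<Sum>m<n. cnj (z (i, m) \<omega>) * z (j, m) \<omega>) / of_nat n - (if i = j then 1 else 0))"
  shows "integrable M D" and "expectation D \<le> (2 * C + 3) / (2 * sqrt n)"
proof -
  define \<delta> :: complex where "\<delta> = (if i = j then 1 else 0)"
  define W where "W m \<omega> = cnj (z (i, m) \<omega>) * z (j, m) \<omega> - \<delta>" for m \<omega>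
  have zm: "z p \<in> borel_measurable M" if "p \<in> {..<K} \<times> {..<n}" for p
    using int[OF that] by (rule borel_measurable_integrable)
  have Wm: "W m \<in> borel_measurable M" if "m < n" for m
    using zm[of "(i, m)"] zm[of "(j, m)"] that i j unfolding W_def by auto
  have W_sq_le: "(cmod (W m \<omega>))\<^sup>2 \<le> cmod (z (i, m) \<omega>) ^ 4 + cmod (z (j, m) \<omega>) ^ 4 + 2" for m \<omega>
  proof -
    have "(cmod (W m \<omega>))\<^sup>2 \<le> 2 * (cmod (cnj (z (i, m) \<omega>) * z (j, m) \<omega>))\<^sup>2 + 2 * (cmod (- \<delta>))\<^sup>2"
      using norm_add_sq_le[of "cnj (z (i, m) \<omega>) * z (j, m) \<omega>" "- \<delta>"] by (simp add: W_def)
    also have "\<dots> \<le> 2 * ((cmod (z (i, m) \<omega>))\<^sup>2 * (cmod (z (j, m) \<omega>))\<^sup>2) + 2"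
      by (simp add: \<delta>_def norm_mult power_mult_distrib)
    also have "\<dots> \<le> cmod (z (i, m) \<omega>) ^ 4 + cmod (z (j, m) \<omega>) ^ 4 + 2"
      using sum_squares_bound[of "(cmod (z (i, m) \<omega>))\<^sup>2" "(cmod (z (j, m) \<omega>))\<^sup>2"] by simp
    finally show ?thesis .
  qed
  have dom: "integrable M (\<lambda>\<omega>. cmod (z (i, m) \<omega>) ^ 4 + cmod (z (j, m) \<omega>) ^ 4 + 2)" if "m < n" for m
    using int4[of "(i, m)"] int4[of "(j, m)"] that i j by auto
  have W_sq: "integrable M (\<lambda>\<omega>. (cmod (W m \<omega>))\<^sup>2)" if "m < n" for m
    by (rule Bochner_Integration.integrable_bound[OF dom[OF that]])
       (use Wm[OF that] W_sq_le in \<open>auto intro!: AE_I2 order_trans[OF W_sq_le]\<close>)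
  have EW_sq: "expectation (\<lambda>\<omega>. (cmod (W m \<omega>))\<^sup>2) \<le> 2 * C + 2" if m: "m < n" for m
  proof -
    have "expectation (\<lambda>\<omega>. (cmod (W m \<omega>))\<^sup>2)
            \<le> expectation (\<lambda>\<omega>. cmod (z (i, m) \<omega>) ^ 4 + cmod (z (j, m) \<omega>) ^ 4 + 2)"
      by (rule integral_mono[OF W_sq[OF m] dom[OF m] W_sq_le])
    also have "\<dots> = expectation (\<lambda>\<omega>. cmod (z (i, m) \<omega>) ^ 4) + expectation (\<lambda>\<omega>. cmod (z (j, m) \<omega>) ^ 4) + 2"
      using int4[of "(i, m)"] int4[of "(j, m)"] m i j by (simp add: prob_space)
    also have "\<dots> \<le> 2 * C + 2" using kurt[of "(i, m)"] kurt[of "(j, m)"] m i j by simp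
    finally show ?thesis .
  qed
  have W_int: "integrable M (W m)" if "m < n" for m
  proof (rule Bochner_Integration.integrable_bound)
    show "integrable M (\<lambda>\<omega>. 1 + (cmod (W m \<omega>))\<^sup>2)" using W_sq[OF that] by simp
    have "x \<le> 1 + x\<^sup>2" for x :: real
      using sum_squares_bound[of x 1] zero_le_power2[of x] by (simp only: mult_1_right one_power2)
    then show "AE \<omega> in M. cmod (W m \<omega>) \<le> norm (1 + (cmod (W m \<omega>))\<^sup>2)"
      by (intro AE_I2) (auto intro: order_trans[OF _ abs_ge_self])
  qed (rule Wm[OF that])
  have EW: "expectation (W m) = 0" if m: "m < n" for m
  proof (cases "i = j")
    case True
    have "W m = (\<lambda>\<omega>. complex_of_real ((cmod (z (i, m) \<omega>))\<^sup>2 - 1))"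
      unfolding W_def of_real_diff complex_norm_square by (auto simp: fun_eq_iff True \<delta>_def mult.commute)
    then have "expectation (W m) = complex_of_real (expectation (\<lambda>\<omega>. (cmod (z (i, m) \<omega>))\<^sup>2 - 1))"
      by (simp only: integral_complex_of_real)
    also have "expectation (\<lambda>\<omega>. (cmod (z (i, m) \<omega>))\<^sup>2 - 1) = 0"
    proof -
      \<comment> \<open>A non-integrable function has Bochner integral 0, so an expectation equal to
        1 already implies integrability.\<close>
      have "integrable M (\<lambda>\<omega>. (cmod (z (i, m) \<omega>))\<^sup>2)"
        using var[of "(i, m)"] not_integrable_integral_eq[of M "\<lambda>\<omega>. (cmod (z (i, m) \<omega>))\<^sup>2"] m i by auto
      then show ?thesis using var[of "(i, m)"] m i by (simp add: prob_space)
    qed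
    finally show ?thesis by simp
  next
    case False
    have "indep_var borel (z (i, m)) borel (z (j, m))"
      by (rule indep_var_of_indep_vars[OF indep]) (use False m i j in auto)
    then have "indep_var borel (cnj \<circ> z (i, m)) borel (id \<circ> z (j, m))"
      by (rule indep_var_compose) auto
    then have "expectation (\<lambda>\<omega>. (cnj \<circ> z (i, m)) \<omega> * (id \<circ> z (j, m)) \<omega>)
        = expectation (cnj \<circ> z (i, m)) * expectation (id \<circ> z (j, m))"
      using int[of "(i, m)"] int[of "(j, m)"] m i j
      by (intro indep_var_lebesgue_integral) (auto simp: comp_def)
    moreover have "W m = (\<lambda>\<omega>. (cnj \<circ> z (i, m)) \<omega> * (id \<circ> z (j, m)) \<omega>)"
      by (simp add: fun_eq_iff W_def \<delta>_def False)
    ultimately show ?thesis using mean[of "(j, m)"] m j by simp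
  qed
  have orth: "integrable M (\<lambda>\<omega>. W m \<omega> * cnj (W l \<omega>)) \<and> expectation (\<lambda>\<omega>. W m \<omega> * cnj (W l \<omega>)) = 0"
    if m: "m < n" and l: "l < n" and ml: "m \<noteq> l" for m l
  proof -
    \<comment> \<open>The coordinates belonging to antenna \<open>q\<close>, a singleton if
      \<open>i = j\<close>. \<open>W q\<close> is a measurable function of this block, and distinct
      antennas have disjoint blocks.\<close>
    define A where "A q = {(i, q), (j, q)}" for q :: nat
    define Y where "Y q f = cnj (f (i, q)) * f (j, q) - \<delta>" for q and f :: "nat \<times> nat \<Rightarrow> complex"
    have YM: "Y q \<in> borel_measurable (PiM (A q) (\<lambda>_. borel))" for q
      unfolding Y_def A_def by measurable
    have eq: "W q = Y q \<circ> (\<lambda>\<omega>. restrict (\<lambda>p. z p \<omega>) (A q))" for q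
      by (auto simp: fun_eq_iff W_def Y_def A_def)
    have "indep_var (PiM (A m) (\<lambda>_. borel)) (\<lambda>\<omega>. restrict (\<lambda>p. z p \<omega>) (A m))
                    (PiM (A l) (\<lambda>_. borel)) (\<lambda>\<omega>. restrict (\<lambda>p. z p \<omega>) (A l))"
      by (rule indep_var_restrict[OF indep]) (use m l ml i j in \<open>auto simp: A_def\<close>)
    then have ind: "indep_var borel (W m) borel (cnj \<circ> W l)"
      unfolding eq comp_assoc[symmetric]
      by (rule indep_var_compose) (use YM in \<open>auto simp: comp_def\<close>)
    have "integrable M (cnj \<circ> W l)" using W_int[OF l] by (simp add: comp_def)
    from indep_var_integrable[OF ind W_int[OF m] this] indep_var_lebesgue_integral[OF ind W_int[OF m] this]
    show ?thesis using EW[OF m] by simp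
  qed
  note S = expectation_norm_sum_le[OF Wm W_sq EW_sq orth n]
  have D: "D \<omega> = cmod (\<Sum>m<n. W m \<omega>) / n" for \<omega>
  proof -
    have "(\<Sum>m<n. W m \<omega>) = (\<Sum>m<n. cnj (z (i, m) \<omega>) * z (j, m) \<omega>) - of_nat n * \<delta>"
      by (simp add: W_def sum_subtractf)
    then have "(\<Sum>m<n. cnj (z (i, m) \<omega>) * z (j, m) \<omega>) / of_nat n - \<delta> = (\<Sum>m<n. W m \<omega>) / of_nat n"
      using n by (simp add: field_simps)
    then show ?thesis by (simp add: D_def \<delta>_def norm_divide)
  qed
  show "integrable M D" unfolding D[abs_def] using S(1) by simp
  have "expectation D = expectation (\<lambda>\<omega>. cmod (\<Sum>m<n. W m \<omega>)) / n"
    unfolding D[abs_def] by simp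
  also have "\<dots> \<le> sqrt n * (1 + (2 * C + 2)) / 2 / n"
    using S(2) by (intro divide_right_mono) auto
  also have "\<dots> = (2 * C + 3) / (2 * sqrt n)"
  proof -
    have "sqrt n * (1 + (2 * C + 2)) / 2 / n = (2 * C + 3) / 2 * (sqrt n / n)" by simp
    also have "sqrt n / n = inverse (sqrt n)" using n by (simp add: inverse_eq_divide frac_eq_eq)
    finally show ?thesis by (simp add: field_simps)
  qed
  finally show "expectation D \<le> (2 * C + 3) / (2 * sqrt n)" .
qed

section \<open>The rate at a fixed number of antennas\<close>

lemma borel_measurable_det:
  fixes A :: "'a \<Rightarrow> complex mat"
  assumes A: "\<And>\<omega>. A \<omega> \<in> carrier_mat n n"
    and meas: "\<And>i j. i < n \<Longrightarrow> j < n \<Longrightarrow> (\<lambda>\<omega>. A \<omega> $$ (i, j)) \<in> borel_measurable N"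
  shows "(\<lambda>\<omega>. Determinant.det (A \<omega>)) \<in> borel_measurable N"
proof -
  have "(\<lambda>\<omega>. A \<omega> $$ (i, p i)) \<in> borel_measurable N" if "p permutes {0..<n}" "i < n" for p i
    using meas[of i "p i"] that permutes_in_image[of p "{0..<n}" i] by auto
  then have "(\<lambda>\<omega>. \<Sum>p\<in>{p. p permutes {0..<n}}. signof p * (\<Prod>i = 0..<n. A \<omega> $$ (i, p i)))
      \<in> borel_measurable N"
    by (intro borel_measurable_sum borel_measurable_times borel_measurable_prod) auto
  then show ?thesis unfolding det_def'[OF A] .
qed

lemma mat_delete_diag_index:
  assumes "A \<in> carrier_mat n n" "i < n - 1" "j < n - 1"
  shows "mat_delete A k k $$ (i, j) = A $$ (if i < k then i else Suc i, if j < k then j else Suc j)"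
  using assms by (auto simp: mat_delete_def)

text \<open>
  Without measurability the integral defining the rate would be the junk value 0.
\<close>
lemma borel_measurable_sinr_zf:
  assumes G: "\<And>\<omega>. G \<omega> \<in> carrier_mat M K"
    and meas: "\<And>m i. m < M \<Longrightarrow> i < K \<Longrightarrow> (\<lambda>\<omega>. G \<omega> $$ (m, i)) \<in> borel_measurable N"
    and k: "k < K"
  shows "(\<lambda>\<omega>. sinr K pu pp \<alpha> \<beta> (G \<omega>) (col (zf_detector (G \<omega>)) k) k) \<in> borel_measurable N"
proof -
  let ?A = "\<lambda>\<omega>. mat_adjoint (G \<omega>) * G \<omega>"
  have entry: "(\<lambda>\<omega>. ?A \<omega> $$ (i, j)) \<in> borel_measurable N" if "i < K" "j < K" for i j
    using that meas unfolding gram_index[OF G that]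
    by (intro borel_measurable_sum borel_measurable_times borel_measurable_cnj) auto
  have A: "?A \<omega> \<in> carrier_mat K K" for \<omega> by (rule gram_carrier[OF G])
  have [measurable]: "(\<lambda>\<omega>. Determinant.det (?A \<omega>)) \<in> borel_measurable N"
    by (rule borel_measurable_det[OF A entry])
  have minor: "mat_delete (?A \<omega>) k k \<in> carrier_mat (K - 1) (K - 1)" for \<omega>
    using mat_delete_carrier[OF A] by blast
  have "(\<lambda>\<omega>. mat_delete (?A \<omega>) k k $$ (i, j)) \<in> borel_measurable N" if "i < K - 1" "j < K - 1" for i j
  proof -
    have "mat_delete (?A \<omega>) k k $$ (i, j)
            = ?A \<omega> $$ (if i < k then i else Suc i, if j < k then j else Suc j)" for \<omega>
      using mat_delete_diag_index[OF A that] .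
    then show ?thesis using entry that by simp
  qed
  then have "(\<lambda>\<omega>. Determinant.det (mat_delete (?A \<omega>) k k)) \<in> borel_measurable N"
    by (rule borel_measurable_det[OF minor])
  then have [measurable]: "(\<lambda>\<omega>. cofactor (?A \<omega>) k k) \<in> borel_measurable N"
    by (simp add: cofactor_def)
  show ?thesis
    unfolding sinr_zf_eq_cofactor[OF G k] by measurable
qed

text \<open>Integrates the pointwise logarithmic bound. The law of \<open>G\<close> enters only
  through the mean of its Gram deviation. Integrability of \<open>ln (1 + t)\<close> is itself a
  consequence of the bound: its distance to a constant is dominated by an integrable
  function.\<close>

lemma (in prob_space) zf_rate_deviation:
  assumes G: "\<And>\<omega>. G \<omega> \<in> carrier_mat L K"
    and meas: "\<And>m i. m < L \<Longrightarrow> i < K \<Longrightarrow> (\<lambda>\<omega>. G \<omega> $$ (m, i)) \<in> borel_measurable M"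
    and k: "k < K" and L: "0 < L" and d: "\<And>i. i < K \<Longrightarrow> d i \<noteq> 0"
    and pu: "0 < pu" and N: "0 < noise_level K pu pp \<alpha> \<beta>"
    and int: "integrable M (\<lambda>\<omega>. gram_deviation L K d (G \<omega>))"
  defines "a \<equiv> pu * real L * (d k)\<^sup>2 / noise_level K pu pp \<alpha> \<beta>"
  shows "\<bar>expectation (\<lambda>\<omega>. log 2 (1 + sinr K pu pp \<alpha> \<beta> (G \<omega>) (col (zf_detector (G \<omega>)) k) k)) - log 2 (1 + a)\<bar>
     \<le> expectation (\<lambda>\<omega>. gram_deviation L K d (G \<omega>)) * (1 + ln (1 + a)) / ln 2"
proof -
  define t where "t \<omega> = sinr K pu pp \<alpha> \<beta> (G \<omega>) (col (zf_detector (G \<omega>)) k) k" for \<omega>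
  define \<Delta> where "\<Delta> \<omega> = gram_deviation L K d (G \<omega>)" for \<omega>
  note b = sinr_zf_bounds[where d = d, OF G k L d pu N, folded a_def t_def \<Delta>_def]
  have a: "0 \<le> a" using pu N by (simp add: a_def)
  have \<Delta>: "0 \<le> \<Delta> \<omega>" for \<omega> by (simp add: \<Delta>_def gram_deviation_def sum_nonneg)
  have tm [measurable]: "t \<in> borel_measurable M"
    unfolding t_def by (rule borel_measurable_sinr_zf[OF G meas k])
  have dev: "\<bar>ln (1 + t \<omega>) - ln (1 + a)\<bar> \<le> \<Delta> \<omega> * (1 + ln (1 + a))" for \<omega>
    by (rule concave_ln_bound[OF a \<Delta>]) (use b in auto)
  have int': "integrable M (\<lambda>\<omega>. \<Delta> \<omega> * (1 + ln (1 + a)))"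
    using int by (simp add: \<Delta>_def)
  have int_dev: "integrable M (\<lambda>\<omega>. ln (1 + t \<omega>) - ln (1 + a))"
    by (rule Bochner_Integration.integrable_bound[OF int'])
       (use dev in \<open>auto intro!: AE_I2 intro: order_trans[OF _ abs_ge_self]\<close>)
  have int_ln: "integrable M (\<lambda>\<omega>. ln (1 + t \<omega>))"
    using Bochner_Integration.integrable_add[OF int_dev integrable_const[of "ln (1 + a)"]] by simp
  have "\<bar>expectation (\<lambda>\<omega>. ln (1 + t \<omega>)) - ln (1 + a)\<bar>
          = \<bar>expectation (\<lambda>\<omega>. ln (1 + t \<omega>) - ln (1 + a))\<bar>"
    using int_ln by (simp add: prob_space)
  also have "\<dots> \<le> expectation (\<lambda>\<omega>. \<bar>ln (1 + t \<omega>) - ln (1 + a)\<bar>)"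
    by (rule integral_abs_bound)
  also have "\<dots> \<le> expectation (\<lambda>\<omega>. \<Delta> \<omega> * (1 + ln (1 + a)))"
    by (rule integral_mono[OF _ int' dev]) (use int_dev in simp)
  also have "\<dots> = expectation \<Delta> * (1 + ln (1 + a))" by simp
  finally have "\<bar>expectation (\<lambda>\<omega>. ln (1 + t \<omega>)) - ln (1 + a)\<bar> / ln 2
      \<le> expectation \<Delta> * (1 + ln (1 + a)) / ln 2"
    by (intro divide_right_mono) auto
  moreover have "expectation (\<lambda>\<omega>. log 2 (1 + t \<omega>)) - log 2 (1 + a)
      = (expectation (\<lambda>\<omega>. ln (1 + t \<omega>)) - ln (1 + a)) / ln 2"
    by (simp add: log_def diff_divide_distrib)
  ultimately show ?thesis by (simp add: t_def \<Delta>_def[abs_def] abs_divide)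
qed

text \<open>Aging factor times MMSE gain times the standard deviation
  \<open>sqrt (\<beta> k + 1 / pp)\<close> of an observation entry. The sign of \<alpha> is kept, so
  the CSI is exactly this multiple of a unit-variance variable.\<close>

definition csi_scale :: "real \<Rightarrow> real \<Rightarrow> (nat \<Rightarrow> real) \<Rightarrow> nat \<Rightarrow> real" where
  "csi_scale pp \<alpha> \<beta> k = \<alpha> * (pp * \<beta> k / (1 + pp * \<beta> k)) * sqrt (\<beta> k + 1 / pp)"

lemma csi_scale_nonzero:
  assumes "0 < pp" "0 < \<beta> k" "\<alpha> \<noteq> 0"
  shows "csi_scale pp \<alpha> \<beta> k \<noteq> 0"
proof -
  have "0 < \<beta> k + 1 / pp" "0 < 1 + pp * \<beta> k" using assms by (simp_all add: add_pos_pos)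
  then show ?thesis using assms by (simp add: csi_scale_def)
qed

text \<open>This is the variance of an aged CSI entry, that is, \<open>\<alpha>\<^sup>2\<close>
  times the variance of the MMSE estimate. The observation variance
  \<open>(1 + pp * \<beta> k) / pp\<close> cancels one factor of the squared gain.\<close>

lemma csi_scale_sq:
  assumes "0 < pp" "0 < \<beta> k"
  shows "(csi_scale pp \<alpha> \<beta> k)\<^sup>2 = \<alpha>\<^sup>2 * pp * (\<beta> k)\<^sup>2 / (1 + pp * \<beta> k)"
proof -
  have pos: "0 < \<beta> k + 1 / pp" "0 < 1 + pp * \<beta> k" using assms by (simp_all add: add_pos_pos)
  have "(csi_scale pp \<alpha> \<beta> k)\<^sup>2 = \<alpha>\<^sup>2 * (pp * \<beta> k / (1 + pp * \<beta> k))\<^sup>2 * (\<beta> k + 1 / pp)"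
    unfolding csi_scale_def power_mult_distrib using pos by simp
  also have "\<beta> k + 1 / pp = (1 + pp * \<beta> k) / pp" using assms by (simp add: field_simps)
  finally show ?thesis using assms pos by (simp add: power2_eq_square divide_simps)
qed

section \<open>Standardized observations in the uplink model\<close>

context aged_uplink
begin

definition normalized_observation :: "real \<Rightarrow> nat \<times> nat \<Rightarrow> 'w \<Rightarrow> complex" where
  "normalized_observation pp = (\<lambda>(k, m) \<omega>. observation pp g b k m \<omega> / of_real (sqrt (\<beta> k + 1 / pp)))"

context
  fixes pp :: real
  assumes pp: "0 < pp" and \<beta>: "\<And>i. i < K \<Longrightarrow> 0 < \<beta> i"
begin

lemma source_borel:
  assumes "k < K" "m < M"
  shows "g k m \<in> borel_measurable \<Omega>" "b k m \<in> borel_measurable \<Omega>"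
proof -
  have "Channel k m \<in> sources M K" "Noise k m \<in> sources M K"
    using assms by (auto simp: sources_def)
  then show "g k m \<in> borel_measurable \<Omega>" "b k m \<in> borel_measurable \<Omega>"
    using independent_sources unfolding indep_vars_def by (metis source.case)+
qed

lemma channel_noise_indep:
  assumes "k < K" "m < M"
  shows "indep_var borel (g k m) borel (b k m)"
  using indep_var_of_indep_vars[OF independent_sources, of "Channel k m" "Noise k m"] assms
  by (auto simp: sources_def)

text \<open>Each entry is a measurable function of its own block of sources, the channel and noise
  at one (user, antenna) pair, and these blocks are pairwise disjoint.\<close>

lemma normalized_observation_indep:
  "indep_vars (\<lambda>_. borel) (normalized_observation pp) ({..<K} \<times> {..<M})"
proof -
  define J where "J = (\<lambda>(k, m). {Channel k m, Noise k m})"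
  define Y where "Y = (\<lambda>(k, m) (f :: source \<Rightarrow> complex).
    (f (Channel k m) + of_real (1 / sqrt pp) * f (Noise k m)) / of_real (sqrt (\<beta> k + 1 / pp)))"
  have "indep_vars (\<lambda>p. PiM (J p) (\<lambda>_. borel))
          (\<lambda>p \<omega>. restrict (\<lambda>s. case_source g b e s \<omega>) (J p)) ({..<K} \<times> {..<M})"
    by (rule indep_vars_restrict[OF independent_sources])
       (auto simp: J_def sources_def disjoint_family_on_def)
  then have "indep_vars (\<lambda>_. borel)
      (\<lambda>p \<omega>. Y p (restrict (\<lambda>s. case_source g b e s \<omega>) (J p))) ({..<K} \<times> {..<M})"
  proof (rule indep_vars_compose2)
    fix p show "Y p \<in> borel_measurable (PiM (J p) (\<lambda>_. borel))"
      by (cases p) (simp add: Y_def J_def)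
  qed
  moreover have "(\<lambda>p \<omega>. Y p (restrict (\<lambda>s. case_source g b e s \<omega>) (J p))) = normalized_observation pp"
    by (auto simp: fun_eq_iff Y_def J_def normalized_observation_def observation_def)
  ultimately show ?thesis by simp
qed

text \<open>The cross term in the second moment vanishes because channel and noise are independent
  and centered, leaving \<open>\<beta> k + 1 / pp\<close>, which the normalization divides out. The
  constant 24 is 8 from the fourth-power inequality for sums times 3 from the Gaussian fourth
  moments, with \<open>(\<beta> k)\<^sup>2 + (1 / pp)\<^sup>2\<close> bounded by the square of the
  sum.\<close>

lemma normalized_observation_moments:
  assumes k: "k < K" and m: "m < M"
  defines "z \<equiv> normalized_observation pp (k, m)"
  shows "integrable \<Omega> z" "expectation z = 0" "expectation (\<lambda>\<omega>. (cmod (z \<omega>))\<^sup>2) = 1"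
    "integrable \<Omega> (\<lambda>\<omega>. (cmod (z \<omega>)) ^ 4)" "expectation (\<lambda>\<omega>. (cmod (z \<omega>)) ^ 4) \<le> 24"
proof -
  define v where "v = \<beta> k + 1 / pp"
  define c where "c = 1 / sqrt pp"
  have c2: "c\<^sup>2 = 1 / pp" and c4: "c ^ 4 = (1 / pp)\<^sup>2"
    using pp power_mult[of c 2 2] by (simp_all add: c_def power_divide)
  have v: "0 < v" using pp \<beta>[OF k] by (simp add: v_def add_pos_pos)
  have z: "z \<omega> = (g k m \<omega> + of_real c * b k m \<omega>) / of_real (sqrt v)" for \<omega>
    by (simp add: z_def normalized_observation_def observation_def v_def c_def)
  note [measurable] = source_borel[OF k m]
  note gm = complex_normal_mean[OF source_borel(1)[OF k m] channel_law[OF k m] less_imp_le[OF \<beta>[OF k]]]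
    complex_normal_second_moment[OF source_borel(1)[OF k m] channel_law[OF k m] less_imp_le[OF \<beta>[OF k]]]
    complex_normal_fourth_moment[OF source_borel(1)[OF k m] channel_law[OF k m] less_imp_le[OF \<beta>[OF k]]]
  note bm = complex_normal_mean[OF source_borel(2)[OF k m] noise_law[OF k m] zero_le_one]
    complex_normal_second_moment[OF source_borel(2)[OF k m] noise_law[OF k m] zero_le_one]
    complex_normal_fourth_moment[OF source_borel(2)[OF k m] noise_law[OF k m] zero_le_one]
  show "integrable \<Omega> z" unfolding z[abs_def] using gm(1) bm(1) by simp
  show "expectation z = 0" unfolding z[abs_def] using gm(1,2) bm(1,2) by simp
  have ind: "indep_var borel (g k m) borel (cnj \<circ> b k m)"
    using indep_var_compose[OF channel_noise_indep[OF k m], of id borel cnj borel]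
    by (simp add: id_def comp_def)
  have int_cross: "integrable \<Omega> (\<lambda>\<omega>. g k m \<omega> * cnj (b k m \<omega>))"
    using indep_var_integrable[OF ind gm(1)] bm(1) by (simp add: comp_def)
  have "expectation (\<lambda>\<omega>. g k m \<omega> * cnj (b k m \<omega>)) = 0"
    using indep_var_lebesgue_integral[OF ind gm(1)] bm(1) gm(2) by (simp add: comp_def)
  then have cross: "expectation (\<lambda>\<omega>. Re (g k m \<omega> * cnj (b k m \<omega>))) = 0"
    using integral_Re[OF int_cross] by simp
  have sq: "(cmod (z \<omega>))\<^sup>2 = ((cmod (g k m \<omega>))\<^sup>2 + (1 / pp) * (cmod (b k m \<omega>))\<^sup>2
              + 2 * c * Re (g k m \<omega> * cnj (b k m \<omega>))) / v" for \<omega>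
  proof -
    have "(cmod (g k m \<omega> + of_real c * b k m \<omega>))\<^sup>2
        = (cmod (g k m \<omega>))\<^sup>2 + c\<^sup>2 * (cmod (b k m \<omega>))\<^sup>2 + 2 * c * Re (g k m \<omega> * cnj (b k m \<omega>))"
      by (simp only: cmod_power2) (simp add: algebra_simps power2_eq_square)
    then show ?thesis using v by (simp only: z norm_divide power_divide c2[symmetric]) simp
  qed
  have "expectation (\<lambda>\<omega>. (cmod (z \<omega>))\<^sup>2)
      = (\<beta> k + (1 / pp) * 1 + 2 * c * expectation (\<lambda>\<omega>. Re (g k m \<omega> * cnj (b k m \<omega>)))) / v"
    unfolding sq using gm(3,4) bm(3,4) integrable_Re[OF int_cross]
    by (simp del: times_complex.sel complex_mult_cnj)
  then show "expectation (\<lambda>\<omega>. (cmod (z \<omega>))\<^sup>2) = 1"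
    using v by (simp only: cross) (simp add: v_def)
  have le: "cmod (z \<omega>) ^ 4 \<le> (8 * cmod (g k m \<omega>) ^ 4 + 8 * (1 / pp)\<^sup>2 * cmod (b k m \<omega>) ^ 4) / v\<^sup>2" for \<omega>
  proof -
    have "cmod (z \<omega>) ^ 4 = cmod (g k m \<omega> + of_real c * b k m \<omega>) ^ 4 / v\<^sup>2"
      using v power_mult[of "sqrt v" 2 2] by (simp add: z norm_divide power_divide)
    also have "\<dots> \<le> (8 * cmod (g k m \<omega>) ^ 4 + 8 * cmod (of_real c * b k m \<omega>) ^ 4) / v\<^sup>2"
      by (intro divide_right_mono norm_add_power4_le) auto
    also have "cmod (of_real c * b k m \<omega>) ^ 4 = (1 / pp)\<^sup>2 * cmod (b k m \<omega>) ^ 4"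
      unfolding norm_mult power_mult_distrib c4[symmetric] by simp
    finally show ?thesis by (simp only: mult.assoc)
  qed
  have dom: "integrable \<Omega> (\<lambda>\<omega>. (8 * cmod (g k m \<omega>) ^ 4 + 8 * (1 / pp)\<^sup>2 * cmod (b k m \<omega>) ^ 4) / v\<^sup>2)"
    using gm(5) bm(5) by simp
  have zm [measurable]: "z \<in> borel_measurable \<Omega>" unfolding z[abs_def] by measurable
  show int4: "integrable \<Omega> (\<lambda>\<omega>. (cmod (z \<omega>)) ^ 4)"
    by (rule Bochner_Integration.integrable_bound[OF dom])
       (use le in \<open>auto intro!: AE_I2 intro: order_trans[OF _ abs_ge_self]\<close>)
  have "expectation (\<lambda>\<omega>. (cmod (z \<omega>)) ^ 4)
      \<le> expectation (\<lambda>\<omega>. (8 * cmod (g k m \<omega>) ^ 4 + 8 * (1 / pp)\<^sup>2 * cmod (b k m \<omega>) ^ 4) / v\<^sup>2)"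
    by (rule integral_mono[OF int4 dom le])
  also have "\<dots> = (8 * expectation (\<lambda>\<omega>. cmod (g k m \<omega>) ^ 4)
                    + 8 * (1 / pp)\<^sup>2 * expectation (\<lambda>\<omega>. cmod (b k m \<omega>) ^ 4)) / v\<^sup>2"
    using gm(5) bm(5) by simp
  also have "\<dots> \<le> (8 * (3 * (\<beta> k)\<^sup>2) + 8 * (1 / pp)\<^sup>2 * (3 * 1\<^sup>2)) / v\<^sup>2"
    by (intro divide_right_mono add_mono mult_left_mono gm(6) bm(6)) auto
  also have "\<dots> \<le> 24 * v\<^sup>2 / v\<^sup>2"
  proof (intro divide_right_mono)
    have "0 \<le> 2 * \<beta> k * (1 / pp)" using pp \<beta>[OF k] by simp
    then show "8 * (3 * (\<beta> k)\<^sup>2) + 8 * (1 / pp)\<^sup>2 * (3 * 1\<^sup>2) \<le> 24 * v\<^sup>2"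
      unfolding v_def power2_sum by simp
  qed simp
  also have "\<dots> = 24" using v by simp
  finally show "expectation (\<lambda>\<omega>. (cmod (z \<omega>)) ^ 4) \<le> 24" .
qed

lemma aged_csi_eq:
  assumes "k < K" "m < M"
  shows "aged_csi M K pp \<alpha> \<beta> g b \<omega> $$ (m, k)
           = of_real (csi_scale pp \<alpha> \<beta> k) * normalized_observation pp (k, m) \<omega>"
proof -
  have "0 < \<beta> k + 1 / pp" using pp \<beta>[OF assms(1)] by (simp add: add_pos_pos)
  then show ?thesis
    using assms by (simp add: aged_csi_def csi_scale_def normalized_observation_def mmse_estimate_def)
qed

text \<open>The scales \<open>csi_scale\<close> cancel, so the deviation is a sum of
  \<open>K\<^sup>2\<close> empirical correlations of standardized observations. The number 51 is
  \<open>2 * C + 3\<close> at the fourth-moment bound \<open>C = 24\<close>.\<close>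

lemma expectation_gram_deviation_le:
  assumes M: "0 < M" and \<alpha>: "\<alpha> \<noteq> 0"
  shows "integrable \<Omega> (\<lambda>\<omega>. gram_deviation M K (csi_scale pp \<alpha> \<beta>) (aged_csi M K pp \<alpha> \<beta> g b \<omega>))"
    and "expectation (\<lambda>\<omega>. gram_deviation M K (csi_scale pp \<alpha> \<beta>) (aged_csi M K pp \<alpha> \<beta> g b \<omega>))
           \<le> (real K)\<^sup>2 * (51 / (2 * sqrt M))"
proof -
  let ?z = "normalized_observation pp"
  define D where "D i j \<omega> = cmod ((\<Sum>m<M. cnj (?z (i, m) \<omega>) * ?z (j, m) \<omega>) / of_nat M - (if i = j then 1 else 0))" for i j \<omega>
  have D: "integrable \<Omega> (D i j)" "expectation (D i j) \<le> 51 / (2 * sqrt M)" if "i < K" "j < K" for i j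
    using expectation_correlation_sum_le[OF normalized_observation_indep _ _ _ _ _ that M, of 24]
      normalized_observation_moments
    unfolding D_def[abs_def] by auto
  have nz: "csi_scale pp \<alpha> \<beta> i \<noteq> 0" if "i < K" for i
    using csi_scale_nonzero[of pp \<beta> i \<alpha>] pp \<beta>[OF that] \<alpha> by simp
  have eq: "gram_deviation M K (csi_scale pp \<alpha> \<beta>) (aged_csi M K pp \<alpha> \<beta> g b \<omega>) = (\<Sum>i<K. \<Sum>j<K. D i j \<omega>)" for \<omega>
    unfolding gram_deviation_def
  proof (intro sum.cong refl)
    fix i j assume ij: "i \<in> {..<K}" "j \<in> {..<K}"
    let ?G = "aged_csi M K pp \<alpha> \<beta> g b \<omega>" and ?d = "csi_scale pp \<alpha> \<beta>"
    have "(\<Sum>m<M. cnj (?G $$ (m, i)) * ?G $$ (m, j))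
        = of_real (?d i * ?d j) * (\<Sum>m<M. cnj (?z (i, m) \<omega>) * ?z (j, m) \<omega>)"
      unfolding sum_distrib_left using ij by (intro sum.cong) (auto simp: aged_csi_eq)
    then have "(\<Sum>m<M. cnj (?G $$ (m, i)) * ?G $$ (m, j)) / of_real (real M * ?d i * ?d j)
        = (\<Sum>m<M. cnj (?z (i, m) \<omega>) * ?z (j, m) \<omega>) / of_nat M"
      using nz ij M by simp
    then show "cmod ((\<Sum>m<M. cnj (?G $$ (m, i)) * ?G $$ (m, j)) / of_real (real M * ?d i * ?d j)
        - (if i = j then 1 else 0)) = D i j \<omega>"
      by (simp add: D_def)
  qed
  show "integrable \<Omega> (\<lambda>\<omega>. gram_deviation M K (csi_scale pp \<alpha> \<beta>) (aged_csi M K pp \<alpha> \<beta> g b \<omega>))"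
    unfolding eq using D(1) by (intro Bochner_Integration.integrable_sum) auto
  have "expectation (\<lambda>\<omega>. gram_deviation M K (csi_scale pp \<alpha> \<beta>) (aged_csi M K pp \<alpha> \<beta> g b \<omega>))
      = (\<Sum>i<K. \<Sum>j<K. expectation (D i j))"
    unfolding eq using D(1)
    by (subst Bochner_Integration.integral_sum)
       (auto intro!: sum.cong Bochner_Integration.integral_sum Bochner_Integration.integrable_sum)
  also have "\<dots> \<le> (\<Sum>i<K. \<Sum>j<K. 51 / (2 * sqrt M))"
    using D(2) by (intro sum_mono) auto
  also have "\<dots> = (real K)\<^sup>2 * (51 / (2 * sqrt M))" by (simp add: power2_eq_square)
  finally show "expectation (\<lambda>\<omega>. gram_deviation M K (csi_scale pp \<alpha> \<beta>) (aged_csi M K pp \<alpha> \<beta> g b \<omega>))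
           \<le> (real K)\<^sup>2 * (51 / (2 * sqrt M))" .
qed

end

text \<open>A bound at finite \<open>M\<close> in which the power enters only through
  \<open>a\<close>; this is what permits letting \<open>pu\<close> vary with \<open>M\<close>
  afterwards.\<close>

lemma rate_aged_zf_deviation:
  assumes \<tau>: "0 < \<tau>" and pu: "0 < pu" and \<beta>: "\<And>i. i < K \<Longrightarrow> 0 < \<beta> i"
    and \<alpha>: "\<alpha> \<noteq> 0" and k: "k < K" and M: "0 < M"
    and N: "0 < noise_level K pu (real \<tau> * pu) \<alpha> \<beta>"
  defines "a \<equiv> pu * real M * (csi_scale (real \<tau> * pu) \<alpha> \<beta> k)\<^sup>2 / noise_level K pu (real \<tau> * pu) \<alpha> \<beta>"
  shows "\<bar>rate_aged_zf \<Omega> M K \<tau> pu \<alpha> \<beta> g b k - log 2 (1 + a)\<bar>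
           \<le> (real K)\<^sup>2 * (51 / (2 * sqrt M)) * (1 + ln (1 + a)) / ln 2"
proof -
  define pp where "pp = real \<tau> * pu"
  have pp: "0 < pp" using \<tau> pu by (simp add: pp_def)
  let ?G = "aged_csi M K pp \<alpha> \<beta> g b"
  have G: "?G \<omega> \<in> carrier_mat M K" for \<omega> by (simp add: aged_csi_def)
  have meas: "(\<lambda>\<omega>. ?G \<omega> $$ (m, i)) \<in> borel_measurable \<Omega>" if "m < M" "i < K" for m i
    using borel_measurable_integrable[OF normalized_observation_moments(1)[OF pp \<beta> that(2,1)]]
    by (simp add: aged_csi_eq[OF pp \<beta> that(2,1)])
  have nz: "csi_scale pp \<alpha> \<beta> i \<noteq> 0" if "i < K" for i
    using csi_scale_nonzero[of pp \<beta> i \<alpha>] pp \<beta>[OF that] \<alpha> by simp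
  note E = expectation_gram_deviation_le[OF pp \<beta> M \<alpha>]
  have a0: "0 \<le> a" using pu N by (simp add: a_def)
  have "\<bar>rate_aged_zf \<Omega> M K \<tau> pu \<alpha> \<beta> g b k - log 2 (1 + a)\<bar>
     \<le> expectation (\<lambda>\<omega>. gram_deviation M K (csi_scale pp \<alpha> \<beta>) (?G \<omega>)) * (1 + ln (1 + a)) / ln 2"
    using zf_rate_deviation[OF G meas k M nz pu N[folded pp_def] E(1)]
    by (simp add: rate_aged_zf_def achievable_rate_def pilot_power_def Let_def a_def pp_def)
  also have "\<dots> \<le> (real K)\<^sup>2 * (51 / (2 * sqrt M)) * (1 + ln (1 + a)) / ln 2"
    using E(2) a0 by (intro divide_right_mono mult_right_mono) auto
  finally show ?thesis .
qed

end

section \<open>Limit\<close>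

text \<open>Each summand is a nonnegative error variance, since an estimate has at most the variance
  of the channel and aging shrinks it further.\<close>

lemma noise_level_ge_1:
  assumes "0 \<le> pu" "0 \<le> pp" "\<bar>\<alpha>\<bar> \<le> 1" and \<beta>: "\<And>i. i < K \<Longrightarrow> 0 < \<beta> i"
  shows "1 \<le> noise_level K pu pp \<alpha> \<beta>"
proof -
  have "0 \<le> \<beta> i - \<alpha>\<^sup>2 * (pp * (\<beta> i)\<^sup>2 / (1 + pp * \<beta> i))" if i: "i < K" for i
  proof -
    have p: "0 \<le> pp * \<beta> i" using assms(2) \<beta>[OF i] by simp
    have "\<alpha>\<^sup>2 * (pp * (\<beta> i)\<^sup>2 / (1 + pp * \<beta> i)) \<le> 1 * (pp * (\<beta> i)\<^sup>2 / (1 + pp * \<beta> i))"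
      using assms(2,3) p by (intro mult_right_mono) (auto simp: abs_square_le_1)
    also have "\<dots> \<le> \<beta> i"
      using p \<beta>[OF i] by (simp add: field_simps power2_eq_square)
    finally show ?thesis by simp
  qed
  then have "0 \<le> (\<Sum>i<K. \<beta> i - \<alpha>\<^sup>2 * (pp * (\<beta> i)\<^sup>2 / (1 + pp * \<beta> i)))"
    by (intro sum_nonneg) auto
  then show ?thesis using assms(1) by (simp add: noise_level_def)
qed

text \<open>Follows from \<open>1 + A \<le> q * (1 + A / q)\<close>. The bound is uniform in
  \<open>A\<close>, which matters because \<open>A\<close> grows without bound when \<gamma> < 1/2,
  where continuity of the logarithm at a fixed point would not be enough.\<close>

lemma ln_one_plus_divide_deviation:
  fixes A q :: real
  assumes A: "0 \<le> A" and q: "1 \<le> q"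
  shows "\<bar>ln (1 + A / q) - ln (1 + A)\<bar> \<le> ln q"
proof -
  have Aq: "0 \<le> A / q" using A q by simp
  have "A / q \<le> A" using A q by (simp add: divide_le_eq mult_left_mono[of 1 q A, simplified])
  then have "ln (1 + A / q) \<le> ln (1 + A)" using Aq by (subst ln_le_cancel_iff) auto
  moreover have "ln (1 + A) \<le> ln (q * (1 + A / q))"
    using A q by (subst ln_le_cancel_iff) (auto simp: distrib_left intro: mult_pos_pos add_pos_nonneg)
  moreover have "ln (q * (1 + A / q)) = ln q + ln (1 + A / q)"
    using Aq q by (simp add: ln_mult)
  ultimately show ?thesis by linarith
qed

theorem theorem3:
  fixes K \<tau> k :: nat
    and \<alpha> Eu \<gamma> :: real
    and \<beta> :: "nat \<Rightarrow> real"
    and \<Omega> :: "nat \<Rightarrow> 'w measure"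
    and g b e g_next :: "nat \<Rightarrow> nat \<Rightarrow> nat \<Rightarrow> 'w \<Rightarrow> complex"
  assumes "K \<le> \<tau>"
    and "0 < \<bar>\<alpha>\<bar>" and "\<bar>\<alpha>\<bar> \<le> 1"
    and "\<And>i. i < K \<Longrightarrow> 0 < \<beta> i"
    and "0 < Eu" and "0 < \<gamma>"
    and "\<And>M. K \<le> M \<Longrightarrow> aged_uplink (\<Omega> M) M K \<alpha> \<beta> (g M) (b M) (e M) (g_next M)"
    and "k < K"
  shows "(\<lambda>M. rate_aged_zf (\<Omega> M) M K \<tau> (Eu / real M powr \<gamma>) \<alpha> \<beta> (g M) (b M) k
            - log 2 (1 + \<alpha>\<^sup>2 * real \<tau> * Eu\<^sup>2 * (\<beta> k)\<^sup>2 / real M powr (2 * \<gamma> - 1)))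
         \<longlonglongrightarrow> 0"
proof -
  define pu where "pu M = Eu / real M powr \<gamma>" for M :: nat
  define N where "N M = noise_level K (pu M) (real \<tau> * pu M) \<alpha> \<beta>" for M
  define C where "C = \<alpha>\<^sup>2 * real \<tau> * Eu\<^sup>2 * (\<beta> k)\<^sup>2"
  define A where "A M = C / real M powr (2 * \<gamma> - 1)" for M :: nat
  \<comment> \<open>The exact deterministic SINR is \<open>A M / q M\<close>; both factors of
    \<open>q M\<close> tend to 1 because the power tends to 0.\<close>
  define q where "q M = (1 + real \<tau> * pu M * \<beta> k) * N M" for M
  \<comment> \<open>The first term covers the random fluctuation of the Gram matrix, of order
    \<open>ln M / sqrt M\<close>; the second covers the replacement of \<open>A M / q M\<close> by
    \<open>A M\<close>.\<close>
  define bound where "bound M = (real K)\<^sup>2 * (51 / (2 * sqrt (real M))) * (1 + ln (1 + C * real M)) / ln 2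
      + ln (q M) / ln 2" for M :: nat
  have \<tau>: "0 < \<tau>" using assms(1,8) by simp
  have \<beta>k: "0 < \<beta> k" using assms(4,8) by simp
  have C: "0 < C" using assms(2,5) \<tau> \<beta>k by (simp add: C_def)
  have pu_lim: "pu \<longlonglongrightarrow> 0"
    unfolding pu_def using assms(6) by real_asymp
  have "N \<longlonglongrightarrow> 0 * (\<Sum>i<K. \<beta> i - \<alpha>\<^sup>2 * (real \<tau> * 0 * (\<beta> i)\<^sup>2 / (1 + real \<tau> * 0 * \<beta> i))) + 1"
    unfolding N_def noise_level_def by (intro tendsto_intros pu_lim) simp
  then have "q \<longlonglongrightarrow> (1 + real \<tau> * 0 * \<beta> k) * 1"
    unfolding q_def by (intro tendsto_intros pu_lim) simp
  then have "(\<lambda>M. ln (q M) / ln 2) \<longlonglongrightarrow> ln 1 / ln 2"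
    by (intro tendsto_intros) simp_all
  moreover have "(\<lambda>M::nat. (real K)\<^sup>2 * (51 / (2 * sqrt (real M))) * (1 + ln (1 + C * real M)) / ln 2) \<longlonglongrightarrow> 0"
  proof -
    have "(\<lambda>M::nat. (51 / (2 * sqrt (real M))) * (1 + ln (1 + C * real M))) \<longlonglongrightarrow> 0"
      using C by real_asymp
    from tendsto_mult[OF tendsto_const[of "(real K)\<^sup>2 / ln 2"] this] show ?thesis
      by (simp add: mult_ac)
  qed
  ultimately have bound_lim: "bound \<longlonglongrightarrow> 0"
    unfolding bound_def using tendsto_add by fastforce
  have "norm (rate_aged_zf (\<Omega> M) M K \<tau> (pu M) \<alpha> \<beta> (g M) (b M) k - log 2 (1 + A M)) \<le> bound M"
    if M: "max K 1 \<le> M" for M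
  proof -
    have M0: "0 < M" and KM: "K \<le> M" using M by auto
    interpret aged_uplink "\<Omega> M" M K \<alpha> \<beta> "g M" "b M" "e M" "g_next M"
      by (rule assms(7)[OF KM])
    have pu: "0 < pu M" using assms(5) M0 by (simp add: pu_def)
    have pp: "0 < real \<tau> * pu M" using \<tau> pu by simp
    have N1: "1 \<le> N M"
      unfolding N_def by (rule noise_level_ge_1) (use pu pp assms(3,4) in auto)
    have q1: "1 \<le> q M"
      unfolding q_def using N1 pp \<beta>k mult_mono[of 1 "1 + real \<tau> * pu M * \<beta> k" 1 "N M"] by simp
    have A0: "0 \<le> A M" using C by (simp add: A_def)
    \<comment> \<open>The power enters twice, as data power and through the pilot power
      \<open>\<tau> * pu\<close>. With the array gain \<open>M\<close> this produces the square of
      \<open>Eu\<close> and the exponent \<open>2 * \<gamma> - 1\<close>.\<close>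
    have "(pu M)\<^sup>2 * real M = Eu\<^sup>2 / real M powr (2 * \<gamma> - 1)"
    proof -
      have "(real M powr \<gamma>)\<^sup>2 = real M powr (2 * \<gamma>)"
        by (simp add: power2_eq_square flip: powr_add)
      moreover have "real M powr (2 * \<gamma> - 1) = real M powr (2 * \<gamma>) / real M"
        using M0 by (simp add: powr_diff)
      ultimately show ?thesis by (simp add: pu_def power_divide)
    qed
    then have A_eq: "A M = \<alpha>\<^sup>2 * real \<tau> * (\<beta> k)\<^sup>2 * ((pu M)\<^sup>2 * real M)"
      by (simp add: A_def C_def)
    have a_eq: "pu M * real M * (csi_scale (real \<tau> * pu M) \<alpha> \<beta> k)\<^sup>2 / N M = A M / q M"
      unfolding csi_scale_sq[where \<beta> = \<beta> and k = k, OF pp \<beta>k] A_eq q_def by (simp add: power2_eq_square)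
    have "A M / q M \<le> A M" using A0 q1 by (simp add: divide_le_eq mult_left_mono[of 1 "q M" "A M", simplified])
    \<comment> \<open>Since \<gamma> > 0, growth is at most linear whatever the exponent, so one
      logarithmic bound serves all regimes of \<gamma>.\<close>
    also have "A M \<le> C * real M"
    proof -
      have "real M powr (1 - 2 * \<gamma>) \<le> real M powr 1"
        using M0 assms(6) by (intro powr_mono) auto
      moreover have "A M = C * real M powr (1 - 2 * \<gamma>)"
        using powr_minus_divide[of "real M" "2 * \<gamma> - 1"] by (simp add: A_def)
      ultimately show ?thesis using C by (simp add: mult_left_mono)
    qed
    finally have a_le: "A M / q M \<le> C * real M" .
    have a0: "0 \<le> A M / q M" using A0 q1 by simp
    have "\<bar>rate_aged_zf (\<Omega> M) M K \<tau> (pu M) \<alpha> \<beta> (g M) (b M) k - log 2 (1 + A M / q M)\<bar>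
        \<le> (real K)\<^sup>2 * (51 / (2 * sqrt M)) * (1 + ln (1 + A M / q M)) / ln 2"
      using rate_aged_zf_deviation[OF \<tau> pu assms(4) _ assms(8) M0] assms(2) N1
      unfolding N_def[symmetric] a_eq by simp
    also have "\<dots> \<le> (real K)\<^sup>2 * (51 / (2 * sqrt M)) * (1 + ln (1 + C * real M)) / ln 2"
      using a_le a0 by (intro divide_right_mono mult_left_mono add_left_mono) auto
    finally have 1: "\<bar>rate_aged_zf (\<Omega> M) M K \<tau> (pu M) \<alpha> \<beta> (g M) (b M) k - log 2 (1 + A M / q M)\<bar>
        \<le> (real K)\<^sup>2 * (51 / (2 * sqrt M)) * (1 + ln (1 + C * real M)) / ln 2" .
    have "\<bar>ln (1 + A M / q M) - ln (1 + A M)\<bar> / ln 2 \<le> ln (q M) / ln 2"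
      by (intro divide_right_mono ln_one_plus_divide_deviation A0 q1) simp
    then have 2: "\<bar>log 2 (1 + A M / q M) - log 2 (1 + A M)\<bar> \<le> ln (q M) / ln 2"
      by (simp add: log_def abs_divide flip: diff_divide_distrib)
    show ?thesis using 1 2 unfolding bound_def real_norm_def by linarith
  qed
  then have "eventually (\<lambda>M. norm (rate_aged_zf (\<Omega> M) M K \<tau> (pu M) \<alpha> \<beta> (g M) (b M) k - log 2 (1 + A M)) \<le> bound M) sequentially"
    by (intro eventually_sequentiallyI[of "max K 1"])
  from Lim_null_comparison[OF this bound_lim]
  show ?thesis by (simp add: pu_def A_def C_def)
qed

end
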